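(* Let $d$ be the average Kendall-Tau distance of an election $(\Pi,\mathcal{C})$. There is a fixed-parameter algorithm for \textsc{Distinct OPT Kemeny Ranking Aggregation} parameterized by $d$ which runs in time $O^*(16^{d})$.
   Context: Let $\mathcal{C}$ be a set of $m$ candidates and $\Pi$ a multiset of $n\ge 2$ rankings (complete linear orders) of $\mathcal{C}$. The Kendall-Tau distance $d_{KT}(\pi,\sigma)$ is the number of pairs of candidates that two rankings order differently. The average Kendall-Tau distance is $d=\frac{\sum_{v\in\Pi}\sum_{w\in\Pi} d_{KT}(v,w)}{n(n-1)}$. The Kemeny score of a ranking $Q$ is $\mathrm{Kemeny}_\Pi(Q)=\sum_{\pi\in\Pi} d_{KT}(Q,\pi)$; a Kemeny ranking minimizes it, and $K(\Pi)$ is the set of Kemeny rankings. \textsc{Distinct OPT Kemeny Ranking Aggregation}: given $(\mathcal{C},\Pi,r)$ with integer $r$, output $\min\{r,|K(\Pi)|\}$ distinct Kemeny rankings. $O^*(g)$ denotes $O(g\cdot \mathrm{poly}(\text{input size}))$. *)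

theory Defs
  imports Complex_Main "HOL-Library.Multiset" "HOL-Computational_Algebra.Polynomial"
begin

section \<open>Kemeny rankings\<close>

text \<open>A ranking of \<open>C\<close> is a relation \<open>R\<close> with \<open>linear_order_on C R\<close>;
  \<open>(a, b) \<in> R\<close> means that \<open>a\<close> is ranked before \<open>b\<close> or \<open>a = b\<close>.\<close>

type_synonym 'a ranking = "('a \<times> 'a) set"

definition kt_dist :: "'a ranking \<Rightarrow> 'a ranking \<Rightarrow> nat" where
  "kt_dist \<pi> \<sigma> = card {{a, b} | a b. a \<noteq> b \<and> (a, b) \<in> \<pi> \<and> (b, a) \<in> \<sigma>}"

definition avg_kt_dist :: "'a ranking multiset \<Rightarrow> real" where
  "avg_kt_dist \<Pi> = (\<Sum>v\<in>#\<Pi>. \<Sum>w\<in>#\<Pi>. real (kt_dist v w)) / (real (size \<Pi>) * (real (size \<Pi>) - 1))"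

definition kemeny_score :: "'a ranking multiset \<Rightarrow> 'a ranking \<Rightarrow> nat" where
  "kemeny_score \<Pi> Q = (\<Sum>\<pi>\<in>#\<Pi>. kt_dist Q \<pi>)"

definition kemeny_rankings :: "'a set \<Rightarrow> 'a ranking multiset \<Rightarrow> 'a ranking set" where
  "kemeny_rankings C \<Pi> = {Q. is_arg_min (kemeny_score \<Pi>) (linear_order_on C) Q}"


section \<open>Machine model\<close>

text \<open>Algorithms are programs of a first-order, call-by-value functional language whose only data
  are binary trees (pure Lisp without atoms other than nil; cf. N. D. Jones, \<^emph>\<open>Computability and
  Complexity from a Programming Perspective\<close>). A program is a list of function bodies.
  Variables are de Bruijn indices into the environment, which consists of the let-bound values
  followed by the arguments of the current call.

  Every application of an evaluation rule costs one unit. As trees can be shared, each rule takes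
  a constant number of pointer operations on a RAM; there is no test for structural equality and no
  built-in arithmetic, so no operation of unit cost hides an unbounded amount of work.\<close>

datatype tree = Nl | Cell tree tree

datatype expr =
    Var nat
  | ENil
  | ECons expr expr
  | EHd expr
  | ETl expr
  | EIf expr expr expr
  | ELet expr expr
  | ECall nat "expr list"

type_synonym program = "expr list"

fun hd_tree :: "tree \<Rightarrow> tree" where
  "hd_tree Nl = Nl"
| "hd_tree (Cell x y) = x"

fun tl_tree :: "tree \<Rightarrow> tree" where
  "tl_tree Nl = Nl"
| "tl_tree (Cell x y) = y"

text \<open>\<open>eval P \<rho> e v t\<close>: in program \<open>P\<close> and environment \<open>\<rho>\<close>, the expression \<open>e\<close> evaluates to \<open>v\<close>
  in exactly \<open>t\<close> steps. Nontermination, unbound variables and undefined functions are expressed by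
  the absence of a result.\<close>

inductive eval :: "program \<Rightarrow> tree list \<Rightarrow> expr \<Rightarrow> tree \<Rightarrow> nat \<Rightarrow> bool"
  and evals :: "program \<Rightarrow> tree list \<Rightarrow> expr list \<Rightarrow> tree list \<Rightarrow> nat \<Rightarrow> bool"
  for P :: program
where
  eval_Var: "i < length \<rho> \<Longrightarrow> eval P \<rho> (Var i) (\<rho> ! i) 1"
| eval_Nil: "eval P \<rho> ENil Nl 1"
| eval_Cons: "eval P \<rho> e1 v1 t1 \<Longrightarrow> eval P \<rho> e2 v2 t2 \<Longrightarrow>
    eval P \<rho> (ECons e1 e2) (Cell v1 v2) (t1 + t2 + 1)"
| eval_Hd: "eval P \<rho> e v t \<Longrightarrow> eval P \<rho> (EHd e) (hd_tree v) (t + 1)"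
| eval_Tl: "eval P \<rho> e v t \<Longrightarrow> eval P \<rho> (ETl e) (tl_tree v) (t + 1)"
| eval_If_true: "eval P \<rho> c w t1 \<Longrightarrow> w \<noteq> Nl \<Longrightarrow> eval P \<rho> e1 v t2 \<Longrightarrow>
    eval P \<rho> (EIf c e1 e2) v (t1 + t2 + 1)"
| eval_If_false: "eval P \<rho> c Nl t1 \<Longrightarrow> eval P \<rho> e2 v t2 \<Longrightarrow>
    eval P \<rho> (EIf c e1 e2) v (t1 + t2 + 1)"
| eval_Let: "eval P \<rho> e1 w t1 \<Longrightarrow> eval P (w # \<rho>) e2 v t2 \<Longrightarrow>
    eval P \<rho> (ELet e1 e2) v (t1 + t2 + 1)"
| eval_Call: "f < length P \<Longrightarrow> evals P \<rho> es ws t1 \<Longrightarrow> eval P ws (P ! f) v t2 \<Longrightarrow>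
    eval P \<rho> (ECall f es) v (t1 + t2 + 1)"
| evals_Nil: "evals P \<rho> [] [] 0"
| evals_Cons: "eval P \<rho> e v t1 \<Longrightarrow> evals P \<rho> es vs t2 \<Longrightarrow>
    evals P \<rho> (e # es) (v # vs) (t1 + t2 + 1)"

lemma eval_deterministic:
  "eval P \<rho> e v t \<Longrightarrow> eval P \<rho> e v' t' \<Longrightarrow> v' = v \<and> t' = t"
  "evals P \<rho> es vs s \<Longrightarrow> evals P \<rho> es vs' s' \<Longrightarrow> vs' = vs \<and> s' = s"
proof (induction arbitrary: v' t' and vs' s' rule: eval_evals.inducts)
  case (eval_Var i \<rho>)
  from eval_Var.prems show ?case by cases auto
next
  case (eval_Nil \<rho>)
  from eval_Nil.prems show ?case by cases auto
next
  case (eval_Cons \<rho> e1 v1 t1 e2 v2 t2)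
  from eval_Cons.prems show ?case by cases (use eval_Cons.IH in blast)
next
  case (eval_Hd \<rho> e v t)
  from eval_Hd.prems show ?case by cases (use eval_Hd.IH in blast)
next
  case (eval_Tl \<rho> e v t)
  from eval_Tl.prems show ?case by cases (use eval_Tl.IH in blast)
next
  case (eval_If_true \<rho> c w t1 e1 v t2 e2)
  from eval_If_true.prems show ?case by cases (use eval_If_true.IH eval_If_true.hyps in blast)+
next
  case (eval_If_false \<rho> c t1 e2 v t2 e1)
  from eval_If_false.prems show ?case by cases (use eval_If_false.IH in blast)+
next
  case (eval_Let \<rho> e1 w t1 e2 v t2)
  from eval_Let.prems show ?case by cases (use eval_Let.IH in blast)
next
  case (eval_Call f \<rho> es ws t1 v t2)
  from eval_Call.prems show ?case by cases (use eval_Call.IH in blast)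
next
  case (evals_Nil \<rho>)
  from evals_Nil.prems show ?case by cases auto
next
  case (evals_Cons \<rho> e v t1 es vs t2)
  from evals_Cons.prems show ?case by cases (use evals_Cons.IH in blast)
qed

text \<open>The first function of the program is applied to the input.\<close>

definition runs :: "program \<Rightarrow> tree \<Rightarrow> tree \<Rightarrow> nat \<Rightarrow> bool" where
  "runs P x y t \<longleftrightarrow> eval P [x] (ECall 0 [Var 0]) y t"


section \<open>Encoding of inputs and outputs\<close>

text \<open>Natural numbers are written in binary, least significant bit first.\<close>

fun enc_nat :: "nat \<Rightarrow> tree" where
  "enc_nat n = (if n = 0 then Nl
     else Cell (if odd n then Cell Nl Nl else Nl) (enc_nat (n div 2)))"

declare enc_nat.simps [simp del]

definition enc_list :: "('a \<Rightarrow> tree) \<Rightarrow> 'a list \<Rightarrow> tree" where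
  "enc_list f xs = foldr (\<lambda>x. Cell (f x)) xs Nl"

text \<open>An input \<open>(cs, ps, r)\<close> lists the candidates (which are named by natural numbers) and the votes,
  each vote being a list of the candidates from the most to the least preferred one.\<close>

type_synonym kra_input = "nat list \<times> nat list list \<times> nat"

definition list_ranking :: "'a list \<Rightarrow> 'a ranking" where
  "list_ranking xs = {(xs ! i, xs ! j) | i j. i \<le> j \<and> j < length xs}"

fun candidates :: "kra_input \<Rightarrow> nat set" where
  "candidates (cs, ps, r) = set cs"

fun votes :: "kra_input \<Rightarrow> nat ranking multiset" where
  "votes (cs, ps, r) = image_mset list_ranking (mset ps)"

fun requested :: "kra_input \<Rightarrow> nat" where
  "requested (cs, ps, r) = r"

definition kra_inputs :: "kra_input set" where
  "kra_inputs = {(cs, ps, r). distinct cs \<and> length ps \<ge> 2 \<and>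
     (\<forall>p\<in>set ps. distinct p \<and> set p = set cs)}"

fun enc_input :: "kra_input \<Rightarrow> tree" where
  "enc_input (cs, ps, r) =
     Cell (enc_list enc_nat cs) (Cell (enc_list (enc_list enc_nat) ps) (enc_nat r))"

text \<open>The function \<open>size\<close> of the datatype \<open>tree\<close> counts the cells.\<close>

definition input_size :: "kra_input \<Rightarrow> nat" where
  "input_size x = size (enc_input x)"

definition enc_output :: "nat list list \<Rightarrow> tree" where
  "enc_output = enc_list (enc_list enc_nat)"

definition distinct_opt_kra :: "kra_input \<Rightarrow> nat list list \<Rightarrow> bool" where
  "distinct_opt_kra x qs \<longleftrightarrow>
     (\<forall>q\<in>set qs. distinct q \<and> set q = candidates x \<and>
        list_ranking q \<in> kemeny_rankings (candidates x) (votes x)) \<and>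
     distinct (map list_ranking qs) \<and>
     length qs = min (requested x) (card (kemeny_rankings (candidates x) (votes x)))"

lemma linear_order_on_list_ranking:
  assumes "distinct xs"
  shows "linear_order_on (set xs) (list_ranking xs)"
proof -
  have "trans (list_ranking xs)"
  proof (rule transI)
    fix a b c assume "(a, b) \<in> list_ranking xs" "(b, c) \<in> list_ranking xs"
    then obtain i j k l where "a = xs ! i" "b = xs ! j" "i \<le> j" "j < length xs"
      "b = xs ! k" "c = xs ! l" "k \<le> l" "l < length xs"
      by (auto simp: list_ranking_def)
    moreover from this have "j = k" using assms by (auto simp: nth_eq_iff_index_eq)
    ultimately show "(a, c) \<in> list_ranking xs"
      unfolding list_ranking_def using le_trans by blast
  qed
  moreover have "antisym (list_ranking xs)"
  proof (rule antisymI)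
    fix a b assume "(a, b) \<in> list_ranking xs" "(b, a) \<in> list_ranking xs"
    then obtain i j k l where ij: "a = xs ! i" "b = xs ! j" "i \<le> j" "j < length xs"
      "b = xs ! k" "a = xs ! l" "k \<le> l" "l < length xs"
      unfolding list_ranking_def by blast
    then have "j = k" "i = l" using assms by (auto simp: nth_eq_iff_index_eq)
    with ij show "a = b" by auto
  qed
  moreover have "total_on (set xs) (list_ranking xs)"
  proof (rule total_onI)
    fix a b assume "a \<in> set xs" "b \<in> set xs"
    then obtain i j where "i < length xs" "j < length xs" "a = xs ! i" "b = xs ! j"
      by (auto simp: in_set_conv_nth)
    then show "(a, b) \<in> list_ranking xs \<or> (b, a) \<in> list_ranking xs"
      using nat_le_linear[of i j] by (auto simp: list_ranking_def)
  qed
  moreover have "refl_on (set xs) (list_ranking xs)"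
    unfolding refl_on_def list_ranking_def by (fastforce simp: in_set_conv_nth)
  moreover have "list_ranking xs \<subseteq> set xs \<times> set xs"
    by (auto simp: list_ranking_def)
  ultimately show ?thesis
    by (auto simp: linear_order_on_def partial_order_on_def preorder_on_def)
qed


section \<open>Running times\<close>

text \<open>\<open>O_star I sz g\<close> is \<open>O(g \<cdot> poly(sz))\<close> on the set \<open>I\<close> of inputs. The bound is uniform over \<open>I\<close>.\<close>

definition O_star :: "'i set \<Rightarrow> ('i \<Rightarrow> nat) \<Rightarrow> ('i \<Rightarrow> real) \<Rightarrow> ('i \<Rightarrow> real) set" where
  "O_star I sz g = {f. \<exists>(c::real) (p::real poly).
     \<forall>x\<in>I. \<bar>f x\<bar> \<le> c * \<bar>g x * poly p (real (sz x))\<bar>}"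

end

theory Submission
  imports Defs
begin

text \<open>Rankings are built from the bottom. Placing \<open>x\<close> last among the remaining candidates costs the
  number of pairs (vote, candidate ranked after \<open>x\<close> in this vote). If the cost is less than \<open>n / 2\<close>,
  then moving \<open>x\<close> to the bottom strictly improves every ranking, so \<open>x\<close> is last in every optimal ranking
  and there is nothing to choose. Otherwise every choice costs at least \<open>n / 2\<close>. An optimal ranking has
  score at most \<open>(n - 1) d\<close>, because the average score of a vote is \<open>(n - 1) d\<close>; hence at most \<open>2 d\<close>
  choices are made along a branch, and some vote disagrees with the branch at most \<open>d\<close> times. Encoding a
  choice by the number of remaining candidates that this vote ranks after it shows that the search
  tree has at most \<open>n 8\<^sup>d\<close> nodes on every level. Searching with budgets \<open>0, 1, 2, \<dots>\<close> until a
  ranking is found enumerates exactly the optimal rankings.\<close>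

section \<open>Symbolic evaluation\<close>

text \<open>The junk values of \<open>result\<close> and \<open>steps\<close> on diverging calls are harmless: \<open>safe\<close> demands \<open>halts\<close>
  for every call that is actually executed. This turns the evaluation relation into equations, so
  that the simplifier can run the program symbolically.\<close>

definition halts :: "program \<Rightarrow> nat \<Rightarrow> tree list \<Rightarrow> bool" where
  "halts P f ws \<longleftrightarrow> f < length P \<and> (\<exists>v t. eval P ws (P ! f) v t)"

definition result :: "program \<Rightarrow> nat \<Rightarrow> tree list \<Rightarrow> tree" where
  "result P f ws = (THE v. \<exists>t. eval P ws (P ! f) v t)"

definition steps :: "program \<Rightarrow> nat \<Rightarrow> tree list \<Rightarrow> nat" where
  "steps P f ws = (THE t. \<exists>v. eval P ws (P ! f) v t)"

fun val :: "program \<Rightarrow> tree list \<Rightarrow> expr \<Rightarrow> tree" where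
  "val P \<rho> (Var i) = \<rho> ! i"
| "val P \<rho> ENil = Nl"
| "val P \<rho> (ECons e1 e2) = Cell (val P \<rho> e1) (val P \<rho> e2)"
| "val P \<rho> (EHd e) = hd_tree (val P \<rho> e)"
| "val P \<rho> (ETl e) = tl_tree (val P \<rho> e)"
| "val P \<rho> (EIf c e1 e2) = (if val P \<rho> c \<noteq> Nl then val P \<rho> e1 else val P \<rho> e2)"
| "val P \<rho> (ELet e1 e2) = val P (val P \<rho> e1 # \<rho>) e2"
| "val P \<rho> (ECall f es) = result P f (map (val P \<rho>) es)"

fun cost :: "program \<Rightarrow> tree list \<Rightarrow> expr \<Rightarrow> nat" where
  "cost P \<rho> (Var i) = 1"
| "cost P \<rho> ENil = 1"
| "cost P \<rho> (ECons e1 e2) = cost P \<rho> e1 + cost P \<rho> e2 + 1"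
| "cost P \<rho> (EHd e) = cost P \<rho> e + 1"
| "cost P \<rho> (ETl e) = cost P \<rho> e + 1"
| "cost P \<rho> (EIf c e1 e2) =
     cost P \<rho> c + (if val P \<rho> c \<noteq> Nl then cost P \<rho> e1 else cost P \<rho> e2) + 1"
| "cost P \<rho> (ELet e1 e2) = cost P \<rho> e1 + cost P (val P \<rho> e1 # \<rho>) e2 + 1"
| "cost P \<rho> (ECall f es) =
     sum_list (map (\<lambda>e. cost P \<rho> e + 1) es) + steps P f (map (val P \<rho>) es) + 1"

fun safe :: "program \<Rightarrow> tree list \<Rightarrow> expr \<Rightarrow> bool" where
  "safe P \<rho> (Var i) \<longleftrightarrow> i < length \<rho>"
| "safe P \<rho> ENil \<longleftrightarrow> True"
| "safe P \<rho> (ECons e1 e2) \<longleftrightarrow> safe P \<rho> e1 \<and> safe P \<rho> e2"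
| "safe P \<rho> (EHd e) \<longleftrightarrow> safe P \<rho> e"
| "safe P \<rho> (ETl e) \<longleftrightarrow> safe P \<rho> e"
| "safe P \<rho> (EIf c e1 e2) \<longleftrightarrow>
     safe P \<rho> c \<and> (if val P \<rho> c \<noteq> Nl then safe P \<rho> e1 else safe P \<rho> e2)"
| "safe P \<rho> (ELet e1 e2) \<longleftrightarrow> safe P \<rho> e1 \<and> safe P (val P \<rho> e1 # \<rho>) e2"
| "safe P \<rho> (ECall f es) \<longleftrightarrow> (\<forall>e\<in>set es. safe P \<rho> e) \<and> halts P f (map (val P \<rho>) es)"

lemma result_steps_eqI:
  assumes "eval P ws (P ! f) v t"
  shows "result P f ws = v" "steps P f ws = t"
  unfolding result_def steps_def using assms eval_deterministic(1) by blast+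

lemma eval_halts:
  assumes "halts P f ws"
  shows "eval P ws (P ! f) (result P f ws) (steps P f ws)"
  using assms result_steps_eqI unfolding halts_def by blast

lemma evalsI:
  assumes "\<And>e. e \<in> set es \<Longrightarrow> eval P \<rho> e (val P \<rho> e) (cost P \<rho> e)"
  shows "evals P \<rho> es (map (val P \<rho>) es) (sum_list (map (\<lambda>e. cost P \<rho> e + 1) es))"
  using assms
proof (induction es)
  case (Cons e es)
  then have "evals P \<rho> (e # es) (val P \<rho> e # map (val P \<rho>) es)
    (cost P \<rho> e + sum_list (map (\<lambda>e. cost P \<rho> e + 1) es) + 1)"
    by (intro evals_Cons) auto
  then show ?case by (simp add: add_ac)
qed (simp add: evals_Nil)

text \<open>The induction is over the expression alone. A call is a black box whose termination is
  part of \<open>safe\<close>, so recursion of the program is left to later inductions over its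
  data.\<close>

lemma eval_safe: "safe P \<rho> e \<Longrightarrow> eval P \<rho> e (val P \<rho> e) (cost P \<rho> e)"
proof (induction P \<rho> e rule: safe.induct)
  case (6 P \<rho> c e1 e2)
  then show ?case
    using eval_If_true[of P \<rho> c "val P \<rho> c" "cost P \<rho> c" e1 "val P \<rho> e1" "cost P \<rho> e1" e2]
      eval_If_false[of P \<rho> c "cost P \<rho> c" e2 "val P \<rho> e2" "cost P \<rho> e2" e1]
    by (auto split: if_splits)
next
  case (8 P \<rho> f es)
  have "evals P \<rho> es (map (val P \<rho>) es) (sum_list (map (\<lambda>e. cost P \<rho> e + 1) es))"
    using 8 by (intro evalsI) auto
  moreover have "halts P f (map (val P \<rho>) es)"
    using "8.prems" by simp
  ultimately show ?case
    unfolding val.simps cost.simps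
    by (meson eval_Call eval_halts halts_def)
qed (auto intro: eval_Var eval_Nil eval_Cons eval_Hd eval_Tl eval_Let simp del: One_nat_def)

text \<open>Unfolds exactly one call: once the inner calls are known to halt, result and step count
  are those of the body.\<close>

lemma call_safe:
  assumes "f < length P" "safe P ws (P ! f)"
  shows "halts P f ws \<and> result P f ws = val P ws (P ! f) \<and> steps P f ws = cost P ws (P ! f)"
  using assms eval_safe[OF assms(2)] result_steps_eqI unfolding halts_def by blast

section \<open>The search tree\<close>

fun after :: "'a \<Rightarrow> 'a list \<Rightarrow> 'a list" where
  "after x [] = []"
| "after x (y # ys) = (if x = y then ys else after x ys)"

definition last_cost :: "'a \<Rightarrow> 'a list list \<Rightarrow> nat" where
  "last_cost x ps = (\<Sum>p\<leftarrow>ps. length (after x p))"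

text \<open>Here and below the first argument lists a ranking from the \<^emph>\<open>least\<close> to the most preferred
  candidate, whereas votes start with the most preferred one.\<close>

fun disagreement :: "'a list \<Rightarrow> 'a list \<Rightarrow> nat" where
  "disagreement [] p = 0"
| "disagreement (x # r) p = length (after x p) + disagreement r (remove1 x p)"

definition score :: "'a list \<Rightarrow> 'a list list \<Rightarrow> nat" where
  "score r ps = (\<Sum>p\<leftarrow>ps. disagreement r p)"

definition ballots :: "'a set \<Rightarrow> 'a list list \<Rightarrow> bool" where
  "ballots S ps \<longleftrightarrow> ps \<noteq> [] \<and> (\<forall>p\<in>set ps. distinct p \<and> set p = S)"

text \<open>The first vote doubles as the list of remaining candidates. If the scan meets no forced
  candidate, it falls through to the default \<open>hd ps\<close>, that is, to all of them.\<close>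

fun choices :: "'a list \<Rightarrow> 'a list list \<Rightarrow> 'a list" where
  "choices [] ps = hd ps"
| "choices (x # xs) ps = (if 2 * last_cost x ps < length ps then [x] else choices xs ps)"

text \<open>Budgets are strict: fuel \<open>f\<close> stands for score less than \<open>f\<close>,
  so every recursive call again has positive fuel.\<close>

fun search :: "nat \<Rightarrow> 'a list list \<Rightarrow> nat \<Rightarrow> 'a list list" where
  "search 0 ps f = [[]]"
| "search (Suc k) ps f = concat (map (\<lambda>x. if last_cost x ps < f
     then map (Cons x) (search k (map (remove1 x) ps) (f - last_cost x ps)) else [])
     (choices (hd ps) ps))"

text \<open>Dead ends count as well, since they cost time without producing a ranking.\<close>

fun nodes :: "nat \<Rightarrow> 'a list list \<Rightarrow> nat \<Rightarrow> nat" where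
  "nodes 0 ps f = 1"
| "nodes (Suc k) ps f = 1 + (\<Sum>x\<leftarrow>choices (hd ps) ps. if last_cost x ps < f
     then nodes k (map (remove1 x) ps) (f - last_cost x ps) else 0)"

section \<open>Exchange argument: moving a candidate to the bottom\<close>

lemma score_Cons: "score (x # r) ps = last_cost x ps + score r (map (remove1 x) ps)"
  by (induction ps) (auto simp: score_def last_cost_def)

lemma ballots_remove1: "ballots S ps \<Longrightarrow> ballots (S - {x}) (map (remove1 x) ps)"
  by (auto simp: ballots_def set_remove1_eq)

lemma ballots_length: "ballots S ps \<Longrightarrow> p \<in> set ps \<Longrightarrow> length p = card S"
  by (auto simp: ballots_def distinct_card)

lemma ballots_hd:
  "ballots S ps \<Longrightarrow> hd ps \<in> set ps \<and> distinct (hd ps) \<and> set (hd ps) = S"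
  by (auto simp: ballots_def)

lemma length_after_le: "length (after x p) \<le> length p"
  by (induction p) auto

text \<open>Exactly one of \<open>x\<close> and \<open>y\<close> comes after the other one.\<close>

lemma length_after_remove1:
  assumes "distinct p" "x \<in> set p" "y \<in> set p" "x \<noteq> y"
  shows "length (after y p) + length (after x p) =
    length (after x (remove1 y p)) + length (after y (remove1 x p)) + 1"
  using assms
proof (induction p)
  case (Cons z p)
  consider "z = x" | "z = y" | "z \<noteq> x" "z \<noteq> y" by blast
  then show ?case
  proof cases
    case 1
    with Cons.prems show ?thesis
      using length_pos_if_in_set[of y p] by (auto simp: length_remove1)
  next
    case 2
    with Cons.prems show ?thesis
      using length_pos_if_in_set[of x p] by (auto simp: length_remove1)
  next
    case 3
    with Cons show ?thesis by simp
  qed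
qed simp

text \<open>Lifting a candidate of \<open>r\<close> above \<open>x\<close> creates a disagreement if
  \<open>p\<close> ranks it after \<open>x\<close> and removes one otherwise. With \<open>a\<close>
  candidates of the first kind the score changes by \<open>2 * a - length r\<close>, and
  \<open>a\<close> is at most \<open>length (after x p)\<close>.\<close>

lemma disagreement_move_to_bottom:
  assumes "distinct p" "distinct (r @ x # l)" "set (r @ x # l) = set p"
  shows "disagreement (x # r @ l) p + length r \<le> disagreement (r @ x # l) p + 2 * length (after x p)"
  using assms
proof (induction r arbitrary: p)
  case (Cons y r)
  have xy: "x \<in> set p" "y \<in> set p" "x \<noteq> y"
    using Cons.prems by auto
  have "set (r @ x # l) = set (remove1 y p)"
    using Cons.prems by auto
  then have "disagreement (x # r @ l) (remove1 y p) + length r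
      \<le> disagreement (r @ x # l) (remove1 y p) + 2 * length (after x (remove1 y p))"
    using Cons.prems by (intro Cons.IH) auto
  moreover have "remove1 x (remove1 y p) = remove1 y (remove1 x p)"
    by (rule remove1_commute)
  ultimately show ?case
    using length_after_remove1[OF Cons.prems(1) xy] by simp
qed simp

lemma score_move_to_bottom:
  assumes "ballots S ps" "distinct (r @ x # l)" "set (r @ x # l) = S"
  shows "score (x # r @ l) ps + length r * length ps \<le> score (r @ x # l) ps + 2 * last_cost x ps"
proof -
  have "\<forall>p\<in>set ps. distinct p \<and> set p = S"
    using assms(1) by (simp add: ballots_def)
  then show ?thesis
  proof (induction ps)
    case (Cons p ps)
    have "disagreement (x # r @ l) p + length r \<le> disagreement (r @ x # l) p + 2 * length (after x p)"
      using Cons.prems assms by (intro disagreement_move_to_bottom) auto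
    moreover have "score (x # r @ l) ps + length r * length ps \<le> score (r @ x # l) ps + 2 * last_cost x ps"
      using Cons by simp
    ultimately show ?case
      by (simp add: score_def last_cost_def del: disagreement.simps)
  qed (simp add: score_def last_cost_def)
qed

definition optimal :: "'a set \<Rightarrow> 'a list list \<Rightarrow> 'a list \<Rightarrow> bool" where
  "optimal S ps q \<longleftrightarrow> is_arg_min (\<lambda>q. score q ps) (\<lambda>q. distinct q \<and> set q = S) q"

lemma optimal_iff: "optimal S ps q \<longleftrightarrow> distinct q \<and> set q = S \<and>
    (\<forall>q'. distinct q' \<and> set q' = S \<longrightarrow> score q ps \<le> score q' ps)"
  by (auto simp: optimal_def is_arg_min_linorder)

lemma optimalD: "optimal S ps q \<Longrightarrow> distinct q \<and> set q = S"
  unfolding optimal_iff by blast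

lemma optimal_forced_last:
  assumes "ballots S ps" "optimal S ps (y # q)" "x \<in> S" "2 * last_cost x ps < length ps"
  shows "x = y"
proof (rule ccontr)
  assume "x \<noteq> y"
  with assms(3) optimalD[OF assms(2)] have "x \<in> set q" by auto
  then obtain r l where q: "q = r @ x # l" by (metis in_set_conv_decomp)
  have d: "distinct ((y # r) @ x # l)" "set ((y # r) @ x # l) = S"
    using optimalD[OF assms(2)] q by auto
  \<comment> \<open>The block below \<open>x\<close> contains at least \<open>y\<close>, so the gain
    is at least \<open>length ps\<close>, which exceeds the loss
    \<open>2 * last_cost x ps\<close>.\<close>
  have "score (x # (y # r) @ l) ps + length (y # r) * length ps
      \<le> score ((y # r) @ x # l) ps + 2 * last_cost x ps"
    by (rule score_move_to_bottom[OF assms(1) d])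
  moreover have "score (y # q) ps \<le> score (x # (y # r) @ l) ps"
  proof -
    have "distinct (x # (y # r) @ l) \<and> set (x # (y # r) @ l) = S"
      using d by auto
    then show ?thesis using assms(2) unfolding optimal_iff by blast
  qed
  ultimately show False
    using assms(4) q by (simp add: algebra_simps)
qed

text \<open>Optimal substructure: by \<open>score_Cons\<close> the bottom candidate costs the same
  in all rankings that it closes.\<close>

lemma optimal_Cons:
  assumes "optimal S ps (x # q)"
  shows "optimal (S - {x}) (map (remove1 x) ps) q"
proof -
  have x: "distinct (x # q)" "set (x # q) = S"
    using optimalD[OF assms] by blast+
  have "score q (map (remove1 x) ps) \<le> score q' (map (remove1 x) ps)"
    if "distinct q'" "set q' = S - {x}" for q'
  proof -
    have "distinct (x # q') \<and> set (x # q') = S"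
      using that x by auto
    then have "score (x # q) ps \<le> score (x # q') ps"
      using assms unfolding optimal_iff by blast
    then show ?thesis by (simp add: score_Cons)
  qed
  then show ?thesis using x unfolding optimal_iff by auto
qed

section \<open>Soundness, completeness and absence of repetitions\<close>

lemma choices_cases:
  obtains x where "x \<in> set xs" "2 * last_cost x ps < length ps" "choices xs ps = [x]"
  | "\<And>x. x \<in> set xs \<Longrightarrow> length ps \<le> 2 * last_cost x ps" "choices xs ps = hd ps"
proof (induction xs arbitrary: thesis)
  case (Cons x xs)
  show ?case
  proof (cases "2 * last_cost x ps < length ps")
    case False
    show ?thesis
    proof (rule Cons.IH)
      fix z assume "z \<in> set xs" "2 * last_cost z ps < length ps" "choices xs ps = [z]"
      then show ?thesis using False by (intro Cons.prems(1)[of z]) auto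
    next
      assume "\<And>z. z \<in> set xs \<Longrightarrow> length ps \<le> 2 * last_cost z ps" "choices xs ps = hd ps"
      then show ?thesis using False by (intro Cons.prems(2)) auto
    qed
  qed (use Cons.prems(1)[of x] in auto)
qed auto

lemma choices_subset: "ballots S ps \<Longrightarrow> set (choices (hd ps) ps) \<subseteq> S"
  by (rule choices_cases[of "hd ps" ps]) (auto simp: ballots_hd)

lemma distinct_choices: "ballots S ps \<Longrightarrow> distinct (choices (hd ps) ps)"
  by (rule choices_cases[of "hd ps" ps]) (auto simp: ballots_hd)

lemma optimal_in_choices:
  assumes "ballots S ps" "optimal S ps (x # q)"
  shows "x \<in> set (choices (hd ps) ps)"
proof (rule choices_cases[of "hd ps" ps])
  fix z assume "z \<in> set (hd ps)" "2 * last_cost z ps < length ps" "choices (hd ps) ps = [z]"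
  then show ?thesis
    using optimal_forced_last[OF assms] assms(1) by (auto simp: ballots_hd)
next
  assume "choices (hd ps) ps = hd ps"
  then show ?thesis
    using optimalD[OF assms(2)] ballots_hd[OF assms(1)] by auto
qed

text \<open>A leaf returns the empty ranking without testing the fuel; \<open>0 < f\<close>
  guarantees that its score 0 is within the budget.\<close>

lemma search_sound:
  assumes "ballots S ps" "card S = k" "finite S" "0 < f" "q \<in> set (search k ps f)"
  shows "distinct q \<and> set q = S \<and> score q ps < f"
  using assms
proof (induction k arbitrary: S ps f q)
  case 0
  from 0(2,3,5) have "q = []" "S = {}" by simp_all
  with 0(4) show ?case by (simp add: score_def)
next
  case (Suc k)
  from Suc.prems(5) obtain x q' where q: "q = x # q'" and x: "x \<in> set (choices (hd ps) ps)"
    and f: "last_cost x ps < f"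
    and q': "q' \<in> set (search k (map (remove1 x) ps) (f - last_cost x ps))"
    by (auto split: if_splits)
  have "x \<in> S" using x choices_subset[OF Suc.prems(1)] by auto
  have IH: "distinct q' \<and> set q' = S - {x} \<and> score q' (map (remove1 x) ps) < f - last_cost x ps"
    by (rule Suc.IH[OF ballots_remove1[OF Suc.prems(1)] _ _ _ q'])
      (use Suc.prems(2,3) \<open>x \<in> S\<close> f in auto)
  then have "score (x # q') ps < f"
    unfolding score_Cons by linarith
  moreover have "distinct (x # q')" "set (x # q') = S"
    using IH \<open>x \<in> S\<close> by auto
  ultimately show ?case unfolding q by blast
qed

text \<open>Forced choices discard only non-optimal rankings, and \<open>optimal_Cons\<close> keeps
  the tail optimal, so the branch of an optimal ranking survives on every level. Other rankings may
  be missed.\<close>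

lemma search_complete:
  assumes "ballots S ps" "card S = k" "optimal S ps q" "score q ps < f"
  shows "q \<in> set (search k ps f)"
  using assms
proof (induction k arbitrary: S ps f q)
  case 0
  with optimalD[OF 0(3)] have "q = []" by auto
  then show ?case by simp
next
  case (Suc k)
  with optimalD[OF Suc.prems(3)] have "card (set q) = Suc k" by auto
  then obtain x q' where q: "q = x # q'" by (cases q) auto
  have "x \<in> S" using optimalD[OF Suc.prems(3)] q by auto
  have "last_cost x ps < f" "score q' (map (remove1 x) ps) < f - last_cost x ps"
    using Suc.prems(4) q by (auto simp: score_Cons)
  moreover from this have "q' \<in> set (search k (map (remove1 x) ps) (f - last_cost x ps))"
    using Suc.prems q \<open>x \<in> S\<close> by (intro Suc.IH[of "S - {x}"] ballots_remove1 optimal_Cons) auto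
  moreover have "x \<in> set (choices (hd ps) ps)"
    using optimal_in_choices[OF Suc.prems(1)] Suc.prems(3) q by simp
  ultimately show ?case using q by (auto intro!: bexI[of _ x])
qed

lemma distinct_concat_map_Cons:
  assumes "\<And>x. x \<in> set xs \<Longrightarrow> distinct (g x)" "distinct xs"
    "\<And>x q. q \<in> set (g x) \<Longrightarrow> \<exists>q'. q = x # q'"
  shows "distinct (concat (map g xs))"
  using assms
proof (induction xs)
  case (Cons a xs)
  have "set (g a) \<inter> (\<Union>x\<in>set xs. set (g x)) = {}"
  proof (rule ccontr)
    assume "set (g a) \<inter> (\<Union>x\<in>set xs. set (g x)) \<noteq> {}"
    then obtain q x where "x \<in> set xs" "q \<in> set (g a)" "q \<in> set (g x)" by auto
    with Cons.prems(2) Cons.prems(3)[of q a] Cons.prems(3)[of q x] show False by auto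
  qed
  moreover have "distinct (concat (map g xs))"
    using Cons.prems by (intro Cons.IH) auto
  ultimately show ?case using Cons.prems(1)[of a] by simp
qed simp

lemma distinct_search:
  assumes "ballots S ps" "card S = k" "finite S"
  shows "distinct (search k ps f)"
  using assms
proof (induction k arbitrary: S ps f)
  case (Suc k)
  let ?g = "\<lambda>x. if last_cost x ps < f
     then map (Cons x) (search k (map (remove1 x) ps) (f - last_cost x ps)) else []"
  have "distinct (?g x)" if "x \<in> set (choices (hd ps) ps)" for x
  proof -
    have "x \<in> S" using that choices_subset[OF Suc.prems(1)] by auto
    then have "distinct (search k (map (remove1 x) ps) (f - last_cost x ps))"
      using Suc.prems by (intro Suc.IH[of "S - {x}"] ballots_remove1) auto
    then show ?thesis by (simp add: distinct_map)
  qed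
  moreover have "\<exists>q'. q = x # q'" if "q \<in> set (?g x)" for x q
    using that by (auto split: if_splits)
  ultimately show ?case
    unfolding search.simps
    by (intro distinct_concat_map_Cons distinct_choices[OF Suc.prems(1)])
qed simp

text \<open>Bounds the number of rankings found, on which the cost of the final truncation
  depends.\<close>

lemma length_search_le_nodes: "length (search k ps f) \<le> nodes k ps f"
proof (induction k arbitrary: ps f)
  case (Suc k)
  have "length (search (Suc k) ps f) \<le> (\<Sum>x\<leftarrow>choices (hd ps) ps. if last_cost x ps < f
     then nodes k (map (remove1 x) ps) (f - last_cost x ps) else 0)"
    unfolding search.simps length_concat map_map comp_def
    by (rule sum_list_mono) (use Suc in auto)
  then show ?case by simp
qed simp

section \<open>The size of the search tree\<close>

text \<open>In a vote of length \<open>m\<close> the values \<open>length (after x p)\<close> are 0,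
  ..., \<open>m - 1\<close>, each taken once, so this is a finite geometric series.\<close>

lemma sum_geometric_after_le:
  assumes "distinct p"
  shows "(\<Sum>x\<in>set p. (1/2::real) ^ length (after x p)) \<le> 2 - 2 * (1/2) ^ length p"
  using assms
proof (induction p)
  case (Cons y p)
  have "(\<Sum>x\<in>set p. (1/2::real) ^ length (after x (y # p))) = (\<Sum>x\<in>set p. (1/2) ^ length (after x p))"
    using Cons.prems by (intro sum.cong) auto
  then show ?case using Cons by simp
qed simp

lemma last_cost_eq_sum: "last_cost x ps = (\<Sum>i<length ps. length (after x (ps ! i)))"
  by (simp add: last_cost_def sum_list_sum_nth atLeast0LessThan)

text \<open>Shares with a nonnegative total include a nonnegative one, whose summand is at least 1.
  Thus every node weighs at least 1.\<close>

lemma one_le_weight: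
  fixes \<alpha> :: "nat \<Rightarrow> real"
  assumes "0 < n" "(\<Sum>i<n. \<alpha> i) = real b"
  shows "1 \<le> 4 powr (b / n) * (\<Sum>i<n. 2 powr \<alpha> i)"
proof -
  obtain i where i: "i < n" "0 \<le> \<alpha> i"
  proof (rule ccontr)
    assume "\<not> thesis"
    then have "\<alpha> i < 0" if "i < n" for i
      using that \<open>\<And>i. i < n \<Longrightarrow> 0 \<le> \<alpha> i \<Longrightarrow> thesis\<close> by (meson not_le)
    then have "(\<Sum>i<n. \<alpha> i) < (\<Sum>i<n. 0)"
      using assms(1) by (intro sum_strict_mono) auto
    then show False using assms(2) by simp
  qed
  have "1 \<le> 2 powr \<alpha> i" using i by (simp add: ge_one_powr_ge_zero)
  also have "\<dots> \<le> (\<Sum>i<n. 2 powr \<alpha> i)"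
    using i by (intro member_le_sum) auto
  finally have "1 * 1 \<le> 4 powr (b / n) * (\<Sum>i<n. 2 powr \<alpha> i)"
    by (intro mult_mono) (auto simp: ge_one_powr_ge_zero)
  then show ?thesis by simp
qed

text \<open>For a forced candidate both factors are at most 1. At a branching node every first
  factor is at most 1/2, which cancels the bound 2 on the geometric series of each vote. Hence the
  children together weigh no more than their parent.\<close>

lemma choices_weight_le:
  fixes w :: "nat \<Rightarrow> real"
  assumes "ballots S ps" "n = length ps" "\<And>i. 0 \<le> w i"
  shows "(\<Sum>x\<leftarrow>choices (hd ps) ps. 4 powr (- (last_cost x ps / n)) *
      (\<Sum>i<n. w i * (1/2) ^ length (after x (ps ! i)))) \<le> (\<Sum>i<n. w i)"
proof -
  let ?h = "\<lambda>x. \<Sum>i<n. w i * (1/2) ^ length (after x (ps ! i))"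
  have n: "0 < n" using assms by (simp add: ballots_def)
  have h0: "0 \<le> ?h x" for x by (intro sum_nonneg) (simp add: assms)
  show ?thesis
  proof (rule choices_cases[of "hd ps" ps])
    fix x assume x: "choices (hd ps) ps = [x]"
    have "4 powr (- (last_cost x ps / n)) \<le> (4::real) powr 0"
      by (intro powr_mono) auto
    moreover have "?h x \<le> (\<Sum>i<n. w i)"
      by (intro sum_mono mult_left_le) (auto simp: assms power_le_one)
    ultimately have "4 powr (- (last_cost x ps / n)) * ?h x \<le> 1 * (\<Sum>i<n. w i)"
      by (intro mult_mono h0) auto
    then show ?thesis by (simp add: x)
  next
    assume c: "\<And>x. x \<in> set (hd ps) \<Longrightarrow> length ps \<le> 2 * last_cost x ps"
      and eq: "choices (hd ps) ps = hd ps"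
    have "4 powr (- (last_cost x ps / n)) * ?h x \<le> 1 / 2 * ?h x" if "x \<in> S" for x
    proof -
      have "real n \<le> 2 * last_cost x ps"
        using c[of x] that assms ballots_hd[OF assms(1)] by simp
      then have "- (last_cost x ps / n) \<le> - (1 / 2)"
        using n by (simp add: field_simps)
      then have "4 powr (- (last_cost x ps / n)) \<le> (4::real) powr (- (1 / 2))"
        by (intro powr_mono) auto
      also have "\<dots> = 1 / 2"
        by (simp add: powr_minus powr_half_sqrt field_simps)
      finally show ?thesis by (intro mult_right_mono h0)
    qed
    then have "(\<Sum>x\<in>S. 4 powr (- (last_cost x ps / n)) * ?h x) \<le> (\<Sum>x\<in>S. 1 / 2 * ?h x)"
      by (intro sum_mono) auto
    \<comment> \<open>Exchanging the sums isolates one geometric series per vote.\<close>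
    also have "\<dots> = (\<Sum>i<n. w i * (1 / 2 * (\<Sum>x\<in>S. (1/2) ^ length (after x (ps ! i)))))"
      unfolding sum_distrib_left by (subst sum.swap) (simp only: mult_ac)
    also have "\<dots> \<le> (\<Sum>i<n. w i * 1)"
    proof (intro sum_mono mult_left_mono assms)
      fix i assume "i \<in> {..<n}"
      then have "distinct (ps ! i)" "set (ps ! i) = S"
        using assms by (auto simp: ballots_def)
      then show "1 / 2 * (\<Sum>x\<in>S. (1/2) ^ length (after x (ps ! i))) \<le> (1::real)"
        using sum_geometric_after_le[of "ps ! i"] zero_le_power[of "1/2::real" "length (ps ! i)"]
        by (simp del: zero_le_power zero_le_power_eq)
    qed
    finally show ?thesis
      using ballots_hd[OF assms(1)] by (simp add: eq sum_list_distinct_conv_sum_set)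
  qed
qed

text \<open>Along a branch of the search tree, \<open>\<alpha> i\<close> is what is left of an equal share of the budget after
  subtracting the disagreement with vote \<open>i\<close>. The shares always add up to the remaining budget, so one
  of them is nonnegative at every node. A branching node has children of cost at least \<open>n / 2\<close>, and
  the factor \<open>4 powr - (1 / 2)\<close> that this yields absorbs the geometric series of the weights
  \<open>2 powr - length (after x (ps ! i))\<close>.\<close>

lemma nodes_le_weighted:
  fixes \<alpha> :: "nat \<Rightarrow> real"
  assumes "ballots S ps" "card S = k" "finite S" "n = length ps" "(\<Sum>i<n. \<alpha> i) = real b"
  shows "real (nodes k ps (Suc b)) \<le> real (k + 1) * (4 powr (b / n) * (\<Sum>i<n. 2 powr \<alpha> i))"
  using assms
proof (induction k arbitrary: S ps b \<alpha>)
  case (0 S ps b \<alpha>)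
  then show ?case using one_le_weight[of n \<alpha> b] by (simp add: ballots_def)
next
  case (Suc k S ps b \<alpha>)
  let ?W = "\<Sum>i<n. 2 powr \<alpha> i"
  let ?g = "\<lambda>x. \<Sum>i<n. 2 powr \<alpha> i * (1/2) ^ length (after x (ps ! i))"
  let ?h = "\<lambda>x. 4 powr (- (last_cost x ps / n)) * ?g x"
  let ?m = "\<lambda>x. if last_cost x ps < Suc b
     then nodes k (map (remove1 x) ps) (Suc b - last_cost x ps) else 0"
  have g0: "0 \<le> ?g x" for x by (intro sum_nonneg) simp
  have "real (?m x) \<le> real (k + 1) * 4 powr (b / n) * ?h x" if "x \<in> set (choices (hd ps) ps)" for x
  proof (cases "last_cost x ps < Suc b")
    case True
    let ?\<beta> = "\<lambda>i. \<alpha> i - length (after x (ps ! i))"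
    \<comment> \<open>Fuel \<open>Suc b\<close> admits total cost at most \<open>b\<close>; the
      child is left with fuel \<open>Suc ?c\<close>.\<close>
    let ?c = "b - last_cost x ps"
    have "x \<in> S" using that choices_subset[OF Suc.prems(1)] by auto
    have "real (nodes k (map (remove1 x) ps) (Suc ?c))
        \<le> real (k + 1) * (4 powr (?c / n) * (\<Sum>i<n. 2 powr ?\<beta> i))"
    proof (rule Suc.IH[of "S - {x}"])
      show "(\<Sum>i<n. ?\<beta> i) = real ?c"
        using True Suc.prems by (simp add: sum_subtractf last_cost_eq_sum of_nat_diff)
    qed (use Suc.prems \<open>x \<in> S\<close> in \<open>auto intro: ballots_remove1\<close>)
    also have "(\<Sum>i<n. 2 powr ?\<beta> i) = ?g x"
      by (intro sum.cong) (auto simp: powr_diff powr_realpow power_one_over field_simps)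
    also have "4 powr (?c / n) = (4::real) powr (b / n) * 4 powr (- (last_cost x ps / n))"
      using True by (simp add: of_nat_diff diff_divide_distrib powr_diff powr_minus field_simps)
    finally show ?thesis
      using True by (simp add: Suc_diff_le mult_ac)
  qed (use g0 in auto)
  then have "(\<Sum>x\<leftarrow>choices (hd ps) ps. real (?m x))
      \<le> (\<Sum>x\<leftarrow>choices (hd ps) ps. real (k + 1) * 4 powr (b / n) * ?h x)"
    by (rule sum_list_mono)
  also have "\<dots> = real (k + 1) * 4 powr (b / n) * (\<Sum>x\<leftarrow>choices (hd ps) ps. ?h x)"
    by (rule sum_list_const_mult)
  also have "\<dots> \<le> real (k + 1) * 4 powr (b / n) * ?W"
    by (intro mult_left_mono choices_weight_le[OF Suc.prems(1,4)]) auto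
  \<comment> \<open>The node itself counts 1, at most its weight. With the \<open>k + 1\<close>
    levels below it this makes \<open>k + 2\<close> weights.\<close>
  finally have "1 + (\<Sum>x\<leftarrow>choices (hd ps) ps. real (?m x))
      \<le> 4 powr (b / n) * ?W + real (k + 1) * 4 powr (b / n) * ?W"
    using one_le_weight[of n \<alpha> b] Suc.prems by (intro add_mono) (auto simp: ballots_def)
  moreover have "real (nodes (Suc k) ps (Suc b)) = 1 + (\<Sum>x\<leftarrow>choices (hd ps) ps. real (?m x))"
    by (simp flip: sum_list_of_nat add: comp_def)
  ultimately show ?case by (simp only: of_nat_Suc of_nat_add) argo
qed

text \<open>Equal initial shares \<open>b / n\<close> are used; the bases 4 of the discount and 2 of
  the weights multiply to 8.\<close>

corollary nodes_le:
  assumes "ballots S ps" "card S = k" "finite S" "n = length ps"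
  shows "real (nodes k ps (Suc b)) \<le> real (k + 1) * real n * 8 powr (b / n)"
proof -
  have "0 < n" using assms by (simp add: ballots_def)
  then have "real (nodes k ps (Suc b)) \<le> real (k + 1) * (4 powr (b / n) * (\<Sum>i<n. 2 powr (b / n)))"
    by (intro nodes_le_weighted[OF assms]) simp
  also have "\<dots> = real (k + 1) * real n * (4 powr (b / n) * 2 powr (b / n))"
    by (simp add: mult_ac)
  also have "4 powr (b / n) * 2 powr (b / n) = (8::real) powr (b / n)"
    using powr_mult[of 4 2 "b / n"] by simp
  finally show ?thesis .
qed

section \<open>Lists and linear orders\<close>

lemma list_ranking_Nil [simp]: "list_ranking [] = {}"
  by (simp add: list_ranking_def)

lemma list_ranking_Cons: "list_ranking (x # xs) = {x} \<times> set (x # xs) \<union> list_ranking xs"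
proof -
  have "(a, b) \<in> list_ranking (x # xs) \<longleftrightarrow> a = x \<and> b \<in> set (x # xs) \<or> (a, b) \<in> list_ranking xs" for a b
  proof
    assume "(a, b) \<in> list_ranking (x # xs)"
    then obtain i j where ij: "a = (x # xs) ! i" "b = (x # xs) ! j" "i \<le> j" "j < length (x # xs)"
      by (auto simp: list_ranking_def)
    show "a = x \<and> b \<in> set (x # xs) \<or> (a, b) \<in> list_ranking xs"
    proof (cases i)
      case 0
      then show ?thesis using ij nth_mem[of j "x # xs"] by simp
    next
      case (Suc i')
      then obtain j' where "j = Suc j'" using ij(3) by (cases j) auto
      with Suc ij have "a = xs ! i'" "b = xs ! j'" "i' \<le> j'" "j' < length xs" by auto
      then show ?thesis unfolding list_ranking_def by blast
    qed
  next
    assume "a = x \<and> b \<in> set (x # xs) \<or> (a, b) \<in> list_ranking xs"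
    then show "(a, b) \<in> list_ranking (x # xs)"
    proof
      assume "a = x \<and> b \<in> set (x # xs)"
      then obtain j where "a = (x # xs) ! 0" "b = (x # xs) ! j" "j < length (x # xs)"
        by (metis in_set_conv_nth nth_Cons_0)
      then show ?thesis unfolding list_ranking_def by blast
    next
      assume "(a, b) \<in> list_ranking xs"
      then obtain i j where "a = xs ! i" "b = xs ! j" "i \<le> j" "j < length xs"
        by (auto simp: list_ranking_def)
      then have "a = (x # xs) ! Suc i" "b = (x # xs) ! Suc j" "Suc i \<le> Suc j"
        "Suc j < length (x # xs)" by auto
      then show ?thesis unfolding list_ranking_def by blast
    qed
  qed
  then show ?thesis by auto
qed

lemma list_ranking_subset: "list_ranking xs \<subseteq> set xs \<times> set xs"
  by (induction xs) (auto simp: list_ranking_Cons)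

lemma list_ranking_refl_iff: "(a, a) \<in> list_ranking xs \<longleftrightarrow> a \<in> set xs"
  by (induction xs) (auto simp: list_ranking_Cons)

lemma list_ranking_snoc: "list_ranking (xs @ [x]) = set (xs @ [x]) \<times> {x} \<union> list_ranking xs"
  by (induction xs) (auto simp: list_ranking_Cons)

lemma set_after: "distinct p \<Longrightarrow> set (after x p) = {b. b \<noteq> x \<and> (x, b) \<in> list_ranking p}"
proof (induction p)
  case (Cons y p)
  then show ?case
    using list_ranking_subset[of p] by (cases "x = y") (auto simp: list_ranking_Cons)
qed simp

lemma distinct_after: "distinct p \<Longrightarrow> distinct (after x p)"
  by (induction p) auto

lemma list_ranking_remove1:
  "distinct p \<Longrightarrow> list_ranking (remove1 x p) = {(a, b) \<in> list_ranking p. a \<noteq> x \<and> b \<noteq> x}"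
proof (induction p)
  case (Cons y p)
  have sub: "a \<in> set p" "b \<in> set p" if "(a, b) \<in> list_ranking p" for a b
    using that list_ranking_subset[of p] by auto
  show ?case
  proof (cases "x = y")
    case True
    then show ?thesis using Cons.prems sub by (auto simp: list_ranking_Cons)
  next
    case False
    then show ?thesis using Cons by (auto simp: list_ranking_Cons)
  qed
qed simp

text \<open>The head is the candidate ranked before all others, unique by antisymmetry; deleting it
  from both relations leaves those of the tails. Counting lists is therefore counting
  rankings.\<close>

lemma list_ranking_inject:
  assumes "distinct xs" "distinct ys" "list_ranking xs = list_ranking ys"
  shows "xs = ys"
  using assms
proof (induction xs arbitrary: ys)
  case Nil
  then show ?case by (cases ys) (auto simp: list_ranking_Cons)
next
  case (Cons x xs)
  have eq: "set (x # xs) = set ys"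
    unfolding set_eq_iff list_ranking_refl_iff[symmetric] Cons.prems(3) by simp
  then obtain y zs where ys: "ys = y # zs" by (cases ys) auto
  have xy: "y \<in> set (x # xs)" "x \<in> set ys"
    using eq ys by auto
  have "(x, y) \<in> list_ranking ys"
    unfolding Cons.prems(3)[symmetric] list_ranking_Cons using xy(1) by blast
  moreover have "(y, x) \<in> list_ranking ys"
    using xy(2) unfolding ys list_ranking_Cons by blast
  moreover have "antisym (list_ranking ys)"
    using linear_order_on_list_ranking[OF Cons.prems(2)]
    by (simp add: linear_order_on_def partial_order_on_def)
  ultimately have "x = y" by (meson antisymD)
  have "list_ranking (remove1 x (x # xs)) = list_ranking (remove1 x ys)"
    unfolding list_ranking_remove1[OF Cons.prems(1)] list_ranking_remove1[OF Cons.prems(2)] Cons.prems(3) ..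
  then have "list_ranking xs = list_ranking zs"
    using ys \<open>x = y\<close> by simp
  then have "xs = zs"
    using Cons.prems(1,2) ys by (intro Cons.IH) auto
  then show ?case using ys \<open>x = y\<close> by simp
qed

lemma linear_order_on_greatest:
  assumes "finite A" "A \<noteq> {}" "A \<subseteq> S" "linear_order_on S Q"
  obtains x where "x \<in> A" "\<And>a. a \<in> A \<Longrightarrow> (a, x) \<in> Q"
proof -
  have Q: "refl_on S Q" "trans Q" "total_on S Q"
    using assms(4) by (auto simp: linear_order_on_def partial_order_on_def preorder_on_def)
  have "\<exists>x\<in>A. \<forall>a\<in>A. (a, x) \<in> Q"
    using assms(1-3)
  proof (induction A rule: finite_ne_induct)
    case (singleton x)
    then show ?case using Q by (auto simp: refl_on_def)
  next
    case (insert y F)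
    then obtain x where x: "x \<in> F" "\<forall>a\<in>F. (a, x) \<in> Q" by auto
    have yy: "(y, y) \<in> Q" using Q insert.prems by (auto simp: refl_on_def)
    have "x \<noteq> y" "x \<in> S" "y \<in> S" using x insert by auto
    then consider "(x, y) \<in> Q" | "(y, x) \<in> Q" using Q(3) by (auto simp: total_on_def)
    then show ?case
    proof cases
      case 1
      then show ?thesis using x yy Q(2) by (auto dest: transD)
    next
      case 2
      then show ?thesis using x by auto
    qed
  qed
  then show ?thesis using that by blast
qed

text \<open>The greatest element is the least preferred candidate: it becomes the end of the list,
  and the restriction of the order to the others is handled by induction.\<close>

lemma linear_order_on_list_ranking_ex:
  assumes "finite S" "linear_order_on S Q"
  shows "\<exists>q. distinct q \<and> set q = S \<and> list_ranking q = Q"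
  using assms
proof (induction "card S" arbitrary: S Q)
  case 0
  then have "S = {}" by simp
  moreover have "Q \<subseteq> S \<times> S"
    using 0 by (auto simp: linear_order_on_def partial_order_on_def preorder_on_def)
  ultimately show ?case by (intro exI[of _ "[]"]) auto
next
  case (Suc k)
  have Q: "refl_on S Q" "trans Q" "antisym Q" "total_on S Q" "Q \<subseteq> S \<times> S"
    using Suc.prems by (auto simp: linear_order_on_def partial_order_on_def preorder_on_def)
  have "S \<noteq> {}" using Suc by auto
  then obtain x where x: "x \<in> S" "\<And>a. a \<in> S \<Longrightarrow> (a, x) \<in> Q"
    using linear_order_on_greatest[OF Suc.prems(1) _ subset_refl Suc.prems(2)] by blast
  define R where "R = Q \<inter> (S - {x}) \<times> (S - {x})"
  have "linear_order_on (S - {x}) R"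
    unfolding linear_order_on_def partial_order_on_def preorder_on_def
  proof (intro conjI)
    show "trans R" unfolding R_def by (rule trans_Restr[OF Q(2)])
    show "antisym R" by (rule antisym_subset[OF _ Q(3)]) (simp add: R_def)
    show "refl_on (S - {x}) R" using Q(1) by (auto simp: R_def refl_on_def)
    show "total_on (S - {x}) R" using Q(4) by (auto simp: R_def total_on_def)
    show "R \<subseteq> (S - {x}) \<times> (S - {x})" by (simp add: R_def)
  qed
  then obtain q where q: "distinct q" "set q = S - {x}" "list_ranking q = R"
    using Suc.hyps Suc.prems x(1) by (metis card_Diff_singleton diff_Suc_1 finite_Diff)
  have "b = x" if "(x, b) \<in> Q" for b
    using that x Q(5) antisymD[OF Q(3)] by blast
  then have "list_ranking (q @ [x]) = Q"
    unfolding list_ranking_snoc q(3) using x Q(5) q(2) by (auto simp: R_def)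
  moreover have "distinct (q @ [x])" "set (q @ [x]) = S"
    using q x by auto
  ultimately show ?case by blast
qed

text \<open>Oriented version of the unordered pairs in \<open>kt_dist\<close>. Antisymmetry of the
  first ranking fixes the orientation, and ordered pairs are easier to split.\<close>

definition inversions :: "'a ranking \<Rightarrow> 'a ranking \<Rightarrow> ('a \<times> 'a) set" where
  "inversions \<pi> \<sigma> = {(a, b). a \<noteq> b \<and> (a, b) \<in> \<pi> \<and> (b, a) \<in> \<sigma>}"

lemma kt_dist_eq_card_inversions:
  assumes "antisym \<pi>"
  shows "kt_dist \<pi> \<sigma> = card (inversions \<pi> \<sigma>)"
proof -
  have "{{a, b} | a b. a \<noteq> b \<and> (a, b) \<in> \<pi> \<and> (b, a) \<in> \<sigma>} = (\<lambda>(a, b). {a, b}) ` inversions \<pi> \<sigma>"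
    by (auto simp: inversions_def)
  moreover have "inj_on (\<lambda>(a, b). {a, b}) (inversions \<pi> \<sigma>)"
    using antisymD[OF assms] by (auto simp: inj_on_def inversions_def doubleton_eq_iff)
  ultimately show ?thesis by (simp add: kt_dist_def card_image)
qed

text \<open>Inversions split into those with the bottom candidate \<open>x\<close>, one for each
  candidate that \<open>p\<close> ranks after \<open>x\<close>, and those among the remaining
  candidates. \<open>rev\<close> converts from bottom-first to top-first order.\<close>

lemma card_inversions_eq_disagreement:
  assumes "distinct r" "distinct p" "set r = set p"
  shows "card (inversions (list_ranking (rev r)) (list_ranking p)) = disagreement r p"
  using assms
proof (induction r arbitrary: p)
  case Nil
  then show ?case by (simp add: inversions_def)
next
  case (Cons x r)
  let ?I = "inversions (list_ranking (rev r)) (list_ranking (remove1 x p))"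
  have sub: "list_ranking (rev r) \<subseteq> set r \<times> set r"
    using list_ranking_subset[of "rev r"] by simp
  have "inversions (list_ranking (rev (x # r))) (list_ranking p) = (\<lambda>b. (b, x)) ` set (after x p) \<union> ?I"
    using Cons.prems sub list_ranking_subset[of p]
    by (auto simp: inversions_def list_ranking_snoc set_after list_ranking_remove1)
  moreover have "(\<lambda>b. (b, x)) ` set (after x p) \<inter> ?I = {}"
    using Cons.prems sub by (auto simp: inversions_def)
  moreover have "finite ?I"
    by (rule finite_subset[of _ "set r \<times> set r"]) (use sub in \<open>auto simp: inversions_def\<close>)
  moreover have "card ((\<lambda>b. (b, x)) ` set (after x p)) = length (after x p)"
    using Cons.prems by (subst card_image) (auto simp: inj_on_def distinct_after distinct_card)
  moreover have "card ?I = disagreement r (remove1 x p)"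
    using Cons.prems by (intro Cons.IH) auto
  ultimately show ?case by (simp add: card_Un_disjoint)
qed

lemma kt_dist_list_ranking:
  assumes "distinct q" "distinct p" "set q = set p"
  shows "kt_dist (list_ranking q) (list_ranking p) = disagreement (rev q) p"
  using assms card_inversions_eq_disagreement[of "rev q" p] linear_order_on_list_ranking[OF assms(1)]
  by (simp add: kt_dist_eq_card_inversions linear_order_on_def partial_order_on_def)

lemma sum_list_kt_dist:
  assumes "ballots S ps" "distinct q" "set q = S"
  shows "(\<Sum>p\<leftarrow>ps. kt_dist (list_ranking q) (list_ranking p)) = score (rev q) ps"
  unfolding score_def
  by (intro arg_cong[where f = sum_list] map_cong)
    (use assms in \<open>auto simp: ballots_def kt_dist_list_ranking\<close>)

lemma kemeny_score_list_ranking: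
  assumes "ballots S ps" "distinct q" "set q = S"
  shows "kemeny_score (image_mset list_ranking (mset ps)) (list_ranking q) = score (rev q) ps"
  unfolding sum_list_kt_dist[OF assms, symmetric] kemeny_score_def
  by (simp add: image_mset.compositionality comp_def flip: mset_map sum_mset_sum_list)

text \<open>Every linear order comes from a reversed list of the same score, so minimizing over
  relations and over lists is the same.\<close>

lemma kemeny_rankings_eq_optimal:
  assumes "ballots S ps" "finite S"
  shows "kemeny_rankings S (image_mset list_ranking (mset ps)) = (\<lambda>q. list_ranking (rev q)) ` {q. optimal S ps q}"
proof -
  have 1: "kemeny_score (image_mset list_ranking (mset ps)) (list_ranking (rev q)) = score q ps"
    if "distinct q" "set q = S" for q
    using kemeny_score_list_ranking[OF assms(1), of "rev q"] that by simp
  have 2: "\<exists>q. distinct q \<and> set q = S \<and> Q = list_ranking (rev q)" if "linear_order_on S Q" for Q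
    using linear_order_on_list_ranking_ex[OF assms(2) that] by (metis distinct_rev rev_rev_ident set_rev)
  have 3: "linear_order_on S (list_ranking (rev q))" if "distinct q" "set q = S" for q
    using linear_order_on_list_ranking[of "rev q"] that by simp
  show ?thesis
  proof (intro set_eqI iffI)
    fix Q assume Q: "Q \<in> kemeny_rankings S (image_mset list_ranking (mset ps))"
    then have "linear_order_on S Q"
      by (simp add: kemeny_rankings_def is_arg_min_linorder)
    then obtain q where q: "distinct q" "set q = S" "Q = list_ranking (rev q)" using 2 by blast
    have "score q ps \<le> score q' ps" if "distinct q'" "set q' = S" for q'
      using Q 3[OF that] 1[OF that] 1[OF q(1,2)] q(3)
      by (auto simp: kemeny_rankings_def is_arg_min_linorder)
    then have "optimal S ps q" using q unfolding optimal_iff by blast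
    then show "Q \<in> (\<lambda>q. list_ranking (rev q)) ` {q. optimal S ps q}" using q(3) by blast
  next
    fix Q assume "Q \<in> (\<lambda>q. list_ranking (rev q)) ` {q. optimal S ps q}"
    then obtain q where q: "optimal S ps q" "Q = list_ranking (rev q)" by blast
    have d: "distinct q" "set q = S" using optimalD[OF q(1)] by auto
    have "kemeny_score (image_mset list_ranking (mset ps)) Q
        \<le> kemeny_score (image_mset list_ranking (mset ps)) R" if R: "linear_order_on S R" for R
    proof -
      obtain r where r: "distinct r" "set r = S" "R = list_ranking (rev r)" using 2[OF R] by blast
      then have "score q ps \<le> score r ps" using q(1) unfolding optimal_iff by blast
      then show ?thesis using 1[OF d] 1[OF r(1,2)] q(2) r(3) by simp
    qed
    then show "Q \<in> kemeny_rankings S (image_mset list_ranking (mset ps))"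
      using 3[OF d] q(2) by (simp add: kemeny_rankings_def is_arg_min_linorder)
  qed
qed

lemma optimal_exists:
  assumes "finite S"
  shows "\<exists>q. optimal S ps q"
proof -
  obtain q where "distinct q" "set q = S" using finite_distinct_list[OF assms] by blast
  then show ?thesis
    using ex_has_least_nat[of "\<lambda>q. distinct q \<and> set q = S" q "\<lambda>q. score q ps"]
    unfolding optimal_iff by blast
qed

text \<open>Each vote is itself a competing ranking, so \<open>length ps\<close> times the optimal
  score is at most the sum of all pairwise distances.\<close>

lemma optimal_score_le_avg:
  assumes "ballots S ps" "2 \<le> length ps" "optimal S ps q"
  shows "score q ps / length ps \<le> avg_kt_dist (image_mset list_ranking (mset ps))"
proof -
  let ?n = "real (length ps)"
  let ?D = "\<Sum>v\<leftarrow>ps. real (score (rev v) ps)"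
  have "(\<Sum>v\<leftarrow>ps. real (score q ps)) \<le> ?D"
  proof (rule sum_list_mono)
    fix v assume "v \<in> set ps"
    then have "distinct (rev v) \<and> set (rev v) = S" using assms(1) by (simp add: ballots_def)
    then show "real (score q ps) \<le> real (score (rev v) ps)"
      using assms(3) unfolding optimal_iff by auto
  qed
  then have le: "?n * score q ps \<le> ?D" by (simp add: sum_list_triv)
  have "(\<Sum>p\<leftarrow>ps. real (kt_dist (list_ranking v) (list_ranking p))) = real (score (rev v) ps)"
    if "v \<in> set ps" for v
  proof -
    have "(\<Sum>p\<leftarrow>ps. kt_dist (list_ranking v) (list_ranking p)) = score (rev v) ps"
      using assms(1) that by (intro sum_list_kt_dist) (auto simp: ballots_def)
    then have "real (score (rev v) ps) = sum_list (map real (map (\<lambda>p. kt_dist (list_ranking v) (list_ranking p)) ps))"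
      by (simp only: sum_list_of_nat)
    then show ?thesis by (simp add: comp_def)
  qed
  then have "map (\<lambda>v. \<Sum>p\<leftarrow>ps. real (kt_dist (list_ranking v) (list_ranking p))) ps
      = map (\<lambda>v. real (score (rev v) ps)) ps"
    by simp
  then have "(\<Sum>v\<leftarrow>ps. \<Sum>p\<leftarrow>ps. real (kt_dist (list_ranking v) (list_ranking p))) = ?D"
    by (simp only:)
  then have avg: "avg_kt_dist (image_mset list_ranking (mset ps)) = ?D / (?n * (?n - 1))"
    unfolding avg_kt_dist_def by (simp flip: mset_map add: sum_mset_sum_list comp_def)
  have "score q ps / ?n \<le> ?D / (?n * ?n)"
    using divide_right_mono[OF le, of "?n * ?n"] assms(2) by (auto split: if_splits)
  \<comment> \<open>The smaller denominator is still positive because there are at least two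
    votes.\<close>
  also have "\<dots> \<le> ?D / (?n * (?n - 1))"
    using assms(2) by (intro divide_left_mono mult_left_mono mult_pos_pos sum_list_nonneg) auto
  finally show ?thesis by (simp add: avg)
qed

section \<open>The program\<close>

text \<open>The loop is at position \<open>Suc 0\<close> and not \<open>1\<close> because the simplifier rewrites the latter to the
  former, so that rules about calls of \<open>1\<close> would never apply.\<close>

abbreviation (input) "fn_loop \<equiv> Suc 0"
abbreviation (input) "fn_after \<equiv> 2 :: nat"
abbreviation (input) "fn_remove \<equiv> 3 :: nat"
abbreviation (input) "fn_remove_all \<equiv> 4 :: nat"
abbreviation (input) "fn_drop \<equiv> 5 :: nat"
abbreviation (input) "fn_drop_cost \<equiv> 6 :: nat"
abbreviation (input) "fn_choices \<equiv> 7 :: nat"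
abbreviation (input) "fn_search \<equiv> 8 :: nat"
abbreviation (input) "fn_branch \<equiv> 9 :: nat"
abbreviation (input) "fn_equal \<equiv> 10 :: nat"
abbreviation (input) "fn_pred \<equiv> 11 :: nat"
abbreviation (input) "fn_take \<equiv> 12 :: nat"

text \<open>Costs and budgets are unary and spent by dropping list cells: the list of votes stands
  for its own length in the test for a forced candidate, and fuel is a list shortened by the cost of
  each choice. Accumulators replace concatenation of results. The first round has one unit of
  fuel.\<close>

definition prog :: program where
  "prog = [
    \<comment> \<open>main (input)\<close>
    ECall fn_take [ETl (ETl (Var 0)), ECall fn_loop [EHd (ETl (Var 0)), ECons ENil ENil]],
    \<comment> \<open>loop (votes, fuel)\<close>
    ELet (ECall fn_search [Var 0, Var 1, ENil, ENil])
      (EIf (Var 0) (Var 0) (ECall fn_loop [Var 1, ECons ENil (Var 2)])),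
    \<comment> \<open>after (x, list)\<close>
    EIf (Var 1)
      (EIf (ECall fn_equal [Var 0, EHd (Var 1)]) (ETl (Var 1)) (ECall fn_after [Var 0, ETl (Var 1)]))
      ENil,
    \<comment> \<open>remove (x, list)\<close>
    EIf (Var 1)
      (EIf (ECall fn_equal [Var 0, EHd (Var 1)]) (ETl (Var 1))
        (ECons (EHd (Var 1)) (ECall fn_remove [Var 0, ETl (Var 1)])))
      ENil,
    \<comment> \<open>remove_all (x, votes)\<close>
    EIf (Var 1)
      (ECons (ECall fn_remove [Var 0, EHd (Var 1)]) (ECall fn_remove_all [Var 0, ETl (Var 1)]))
      ENil,
    \<comment> \<open>drop (list, counter)\<close>
    EIf (Var 1) (ECall fn_drop [ETl (Var 0), ETl (Var 1)]) (Var 0),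
    \<comment> \<open>drop_cost (list, x, votes)\<close>
    EIf (Var 2)
      (ECall fn_drop_cost
        [ECall fn_drop [Var 0, ECall fn_after [Var 1, EHd (Var 2)]], Var 1, ETl (Var 2)])
      (Var 0),
    \<comment> \<open>choices (list, votes)\<close>
    EIf (Var 0)
      (EIf (ECall fn_drop_cost
             [ECall fn_drop_cost [Var 1, EHd (Var 0), Var 1], EHd (Var 0), Var 1])
        (ECons (EHd (Var 0)) ENil)
        (ECall fn_choices [ETl (Var 0), Var 1]))
      (EHd (Var 1)),
    \<comment> \<open>search (votes, fuel, suffix, accumulator)\<close>
    EIf (EHd (Var 0))
      (ECall fn_branch [ECall fn_choices [EHd (Var 0), Var 0], Var 0, Var 1, Var 2, Var 3])
      (ECons (Var 2) (Var 3)),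
    \<comment> \<open>branch (choices, votes, fuel, suffix, accumulator)\<close>
    EIf (Var 0)
      (ELet (ECall fn_drop_cost [Var 2, EHd (Var 0), Var 1])
        (ECall fn_branch [ETl (Var 1), Var 2, Var 3, Var 4,
          EIf (Var 0)
            (ECall fn_search [ECall fn_remove_all [EHd (Var 1), Var 2], Var 0,
              ECons (EHd (Var 1)) (Var 4), Var 5])
            (Var 5)]))
      (Var 4),
    \<comment> \<open>equal (tree, tree)\<close>
    EIf (Var 0)
      (EIf (Var 1)
        (EIf (ECall fn_equal [EHd (Var 0), EHd (Var 1)])
          (ECall fn_equal [ETl (Var 0), ETl (Var 1)]) ENil)
        ENil)
      (EIf (Var 1) ENil (ECons ENil ENil)),
    \<comment> \<open>pred (positive binary number)\<close>
    EIf (EHd (Var 0))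
      (EIf (ETl (Var 0)) (ECons ENil (ETl (Var 0))) ENil)
      (ECons (ECons ENil ENil) (ECall fn_pred [ETl (Var 0)])),
    \<comment> \<open>take (binary number, list)\<close>
    EIf (Var 1)
      (EIf (Var 0) (ECons (EHd (Var 1)) (ECall fn_take [ECall fn_pred [Var 0], ETl (Var 1)])) ENil)
      ENil]"

abbreviation enc_vote :: "nat list \<Rightarrow> tree" where
  "enc_vote \<equiv> enc_list enc_nat"

abbreviation enc_votes :: "nat list list \<Rightarrow> tree" where
  "enc_votes \<equiv> enc_list enc_vote"

text \<open>The program tests for nonempty remaining fuel, hence \<open>f\<close> units admit rankings of score less
  than \<open>f\<close>.\<close>

definition enc_fuel :: "nat \<Rightarrow> tree" where
  "enc_fuel n = enc_list (\<lambda>_. Nl) (replicate n ())"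

lemma enc_list_simps [simp]:
  "enc_list f [] = Nl" "enc_list f (x # xs) = Cell (f x) (enc_list f xs)"
  by (simp_all add: enc_list_def)

lemma length_prog: "length prog = 13"
  by (simp add: prog_def)

lemmas nth_prog =
  arg_cong[where f = "\<lambda>p. p ! 0", OF prog_def, simplified]
  arg_cong[where f = "\<lambda>p. p ! Suc 0", OF prog_def, simplified]
  arg_cong[where f = "\<lambda>p. p ! 2", OF prog_def, simplified]
  arg_cong[where f = "\<lambda>p. p ! 3", OF prog_def, simplified]
  arg_cong[where f = "\<lambda>p. p ! 4", OF prog_def, simplified]
  arg_cong[where f = "\<lambda>p. p ! 5", OF prog_def, simplified]
  arg_cong[where f = "\<lambda>p. p ! 6", OF prog_def, simplified]
  arg_cong[where f = "\<lambda>p. p ! 7", OF prog_def, simplified]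
  arg_cong[where f = "\<lambda>p. p ! 8", OF prog_def, simplified]
  arg_cong[where f = "\<lambda>p. p ! 9", OF prog_def, simplified]
  arg_cong[where f = "\<lambda>p. p ! 10", OF prog_def, simplified]
  arg_cong[where f = "\<lambda>p. p ! 11", OF prog_def, simplified]
  arg_cong[where f = "\<lambda>p. p ! 12", OF prog_def, simplified]

section \<open>Correctness and step counts of the functions\<close>

lemma call_prog:
  assumes "f < 13" "safe prog ws (prog ! f)"
  shows "halts prog f ws \<and> result prog f ws = val prog ws (prog ! f) \<and>
    steps prog f ws = cost prog ws (prog ! f)"
  using call_safe[of f prog ws] assms by (simp add: length_prog)

text \<open>Termination, result and step bound are proved together because unfolding a call needs
  its inner calls to halt. \<open>2 * size s + 1\<close> counts the nodes of \<open>s\<close> with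
  its leaves, each compared at most once.\<close>

lemma equal_call:
  "halts prog fn_equal [s, t] \<and> result prog fn_equal [s, t] = (if s = t then Cell Nl Nl else Nl) \<and>
   steps prog fn_equal [s, t] \<le> 30 * (2 * size s + 1)"
proof (induction s arbitrary: t)
  case Nl
  then show ?case
    using call_prog[of fn_equal "[Nl, t]"] by (cases t) (simp_all add: nth_prog)
next
  case (Cell a b)
  show ?case
  proof (cases t)
    case Nl
    then show ?thesis
      using call_prog[of fn_equal "[Cell a b, Nl]"] by (simp add: nth_prog)
  next
    case (Cell c d)
    then show ?thesis
      using call_prog[of fn_equal "[Cell a b, Cell c d]"] Cell.IH(1)[of c] Cell.IH(2)[of d]
      by (auto simp add: nth_prog)
  qed
qed


lemma enc_list_eq_Nl [simp]: "enc_list f xs = Nl \<longleftrightarrow> xs = []"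
  by (cases xs) auto

lemma hd_tree_enc_list: "xs \<noteq> [] \<Longrightarrow> hd_tree (enc_list f xs) = f (hd xs)"
  by (cases xs) auto

lemma funpow_tl_enc_list: "(tl_tree ^^ n) (enc_list f xs) = enc_list f (drop n xs)"
proof (induction n arbitrary: xs)
  case (Suc n)
  have "tl_tree (enc_list f xs) = enc_list f (tl xs)" by (cases xs) auto
  then show ?case using Suc by (simp add: funpow_Suc_right drop_Suc del: funpow.simps)
qed simp

lemma funpow_tl_enc_fuel: "(tl_tree ^^ n) (enc_fuel f) = enc_fuel (f - n)"
  by (simp add: enc_fuel_def funpow_tl_enc_list)

lemma enc_fuel_eq_Nl: "enc_fuel n = Nl \<longleftrightarrow> n = 0"
  by (simp add: enc_fuel_def)

lemma enc_fuel_Suc: "enc_fuel (Suc n) = Cell Nl (enc_fuel n)"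
  by (simp add: enc_fuel_def)

lemma enc_nat_inject: "enc_nat m = enc_nat n \<longleftrightarrow> m = n"
proof (induction m arbitrary: n rule: less_induct)
  case (less m)
  show ?case
  proof (cases "m = 0 \<or> n = 0")
    case True
    then show ?thesis by (auto simp: enc_nat.simps[of m] enc_nat.simps[of n])
  next
    case False
    then have "enc_nat m = enc_nat n \<longleftrightarrow> (odd m \<longleftrightarrow> odd n) \<and> m div 2 = n div 2"
      using less[of "m div 2" "n div 2"] by (simp add: enc_nat.simps[of m] enc_nat.simps[of n])
    then show ?thesis by (metis odd_two_times_div_two_succ even_two_times_div_two)
  qed
qed

text \<open>One comparison takes fewer than \<open>60 * M\<close> steps. Here and below
  \<open>M\<close> is a strict bound on the relevant sizes; it becomes the input size plus
  one.\<close>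

lemma after_call:
  assumes "size (enc_nat x) < M"
  shows "halts prog fn_after [enc_nat x, enc_vote l] \<and>
    result prog fn_after [enc_nat x, enc_vote l] = enc_vote (after x l) \<and>
    steps prog fn_after [enc_nat x, enc_vote l] \<le> 100 * M * (length l + 1)"
proof (induction l)
  case Nil
  then show ?case
    using call_prog[of fn_after "[enc_nat x, enc_vote []]"] assms by (simp add: nth_prog)
next
  case (Cons y l)
  then show ?case
    using call_prog[of fn_after "[enc_nat x, enc_vote (y # l)]"] assms
      equal_call[of "enc_nat x" "enc_nat y"]
    by (auto simp: nth_prog enc_nat_inject)
qed

lemma remove_call:
  assumes "size (enc_nat x) < M"
  shows "halts prog fn_remove [enc_nat x, enc_vote l] \<and>
    result prog fn_remove [enc_nat x, enc_vote l] = enc_vote (remove1 x l) \<and>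
    steps prog fn_remove [enc_nat x, enc_vote l] \<le> 100 * M * (length l + 1)"
proof (induction l)
  case Nil
  then show ?case
    using call_prog[of fn_remove "[enc_nat x, enc_vote []]"] assms by (simp add: nth_prog)
next
  case (Cons y l)
  then show ?case
    using call_prog[of fn_remove "[enc_nat x, enc_vote (y # l)]"] assms
      equal_call[of "enc_nat x" "enc_nat y"]
    by (auto simp: nth_prog enc_nat_inject)
qed

lemma drop_call:
  "halts prog fn_drop [a, enc_list g l] \<and>
   result prog fn_drop [a, enc_list g l] = (tl_tree ^^ length l) a \<and>
   steps prog fn_drop [a, enc_list g l] \<le> 20 * (length l + 1)"
proof (induction l arbitrary: a)
  case Nil
  then show ?case
    using call_prog[of fn_drop "[a, enc_list g []]"] by (simp add: nth_prog)
next
  case (Cons y l)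
  show ?case
    using call_prog[of fn_drop "[a, enc_list g (y # l)]"] Cons.IH[of "tl_tree a"]
    by (simp add: nth_prog funpow_Suc_right del: funpow.simps)
qed

lemma remove_all_call:
  assumes "size (enc_nat x) < M" "\<And>p. p \<in> set ps \<Longrightarrow> length p < M"
  shows "halts prog fn_remove_all [enc_nat x, enc_votes ps] \<and>
    result prog fn_remove_all [enc_nat x, enc_votes ps] = enc_votes (map (remove1 x) ps) \<and>
    steps prog fn_remove_all [enc_nat x, enc_votes ps] \<le> 200 * M ^ 2 * (length ps + 1)"
  using assms(2)
proof (induction ps)
  case Nil
  have "1 \<le> M ^ 2" using assms(1) by simp
  then show ?case
    using call_prog[of fn_remove_all "[enc_nat x, enc_votes []]"] by (simp add: nth_prog)
next
  case (Cons p ps)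
  have "100 * M * (length p + 1) \<le> 100 * M * M"
    using Cons.prems[of p] by (intro mult_le_mono) auto
  then have "steps prog fn_remove [enc_nat x, enc_vote p] \<le> 100 * M ^ 2"
    using remove_call[OF assms(1), of p] by (simp add: power2_eq_square)
  moreover have "1 \<le> M ^ 2" using assms(1) by simp
  ultimately show ?case
    using call_prog[of fn_remove_all "[enc_nat x, enc_votes (p # ps)]"] Cons
      remove_call[OF assms(1), of p]
    by (simp add: nth_prog)
qed

text \<open>The cost of \<open>x\<close> is never computed as a number: the candidates after
  \<open>x\<close> in each vote serve in turn as a unary counter, and the drops add up to
  \<open>last_cost x ps\<close>.\<close>

lemma drop_cost_call:
  assumes "size (enc_nat x) < M" "\<And>p. p \<in> set ps \<Longrightarrow> length p < M"
  shows "halts prog fn_drop_cost [a, enc_nat x, enc_votes ps] \<and>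
    result prog fn_drop_cost [a, enc_nat x, enc_votes ps] = (tl_tree ^^ last_cost x ps) a \<and>
    steps prog fn_drop_cost [a, enc_nat x, enc_votes ps] \<le> 200 * M ^ 2 * (length ps + 1)"
  using assms(2)
proof (induction ps arbitrary: a)
  case Nil
  have "1 \<le> M ^ 2" using assms(1) by simp
  then show ?case
    using call_prog[of fn_drop_cost "[a, enc_nat x, enc_votes []]"]
    by (simp add: nth_prog last_cost_def)
next
  case (Cons p ps)
  let ?a = "(tl_tree ^^ length (after x p)) a"
  have "100 * M * (length p + 1) \<le> 100 * M * M"
    using Cons.prems[of p] by (intro mult_le_mono) auto
  then have "steps prog fn_after [enc_nat x, enc_vote p] \<le> 100 * M ^ 2"
    using after_call[OF assms(1), of p] by (simp add: power2_eq_square)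
  moreover have "steps prog fn_drop [a, enc_vote (after x p)] \<le> 20 * M ^ 2"
  proof -
    have "length (after x p) + 1 \<le> M"
      using Cons.prems[of p] length_after_le[of x p] by simp
    also have "M \<le> M ^ 2" by (simp add: power2_eq_square)
    finally show ?thesis using drop_call[of a enc_nat "after x p"] by simp
  qed
  moreover have "1 \<le> M ^ 2" using assms(1) by simp
  moreover have "(tl_tree ^^ last_cost x (p # ps)) a = (tl_tree ^^ last_cost x ps) ?a"
    by (simp add: last_cost_def add.commute[of "length _"] funpow_add)
  ultimately show ?case
    using call_prog[of fn_drop_cost "[a, enc_nat x, enc_votes (p # ps)]"] Cons.IH[of ?a] Cons.prems
      after_call[OF assms(1), of p] drop_call[of a enc_nat "after x p"]
    by (simp add: nth_prog)
qed

lemma choices_call: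
  assumes "\<And>x. x \<in> set xs \<Longrightarrow> size (enc_nat x) < M" "\<And>p. p \<in> set ps \<Longrightarrow> length p < M"
    "length ps < M" "ps \<noteq> []"
  shows "halts prog fn_choices [enc_vote xs, enc_votes ps] \<and>
    result prog fn_choices [enc_vote xs, enc_votes ps] = enc_vote (choices xs ps) \<and>
    steps prog fn_choices [enc_vote xs, enc_votes ps] \<le> 500 * M ^ 3 * (length xs + 1)"
  using assms(1)
proof (induction xs)
  case Nil
  have "1 \<le> M ^ 3" using assms(3) by simp
  then show ?case
    using call_prog[of fn_choices "[enc_vote [], enc_votes ps]"] assms(4)
    by (simp add: nth_prog hd_tree_enc_list)
next
  case (Cons x xs)
  have x: "size (enc_nat x) < M" using Cons.prems by simp
  let ?a = "(tl_tree ^^ last_cost x ps) (enc_votes ps)"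
  have "200 * M ^ 2 * (length ps + 1) \<le> 200 * M ^ 2 * M"
    using assms(3) by (intro mult_le_mono) auto
  then have le: "200 * M ^ 2 * (length ps + 1) \<le> 200 * M ^ 3"
    by (simp add: power2_eq_square power3_eq_cube)
  have "steps prog fn_drop_cost [enc_votes ps, enc_nat x, enc_votes ps] \<le> 200 * M ^ 3"
    "steps prog fn_drop_cost [?a, enc_nat x, enc_votes ps] \<le> 200 * M ^ 3"
    using drop_cost_call[OF x assms(2)] le le_trans by blast+
  moreover have "1 \<le> M ^ 3" using assms(3) by simp
  \<comment> \<open>Dropping the cost twice from the list of votes leaves something exactly if
    \<open>x\<close> is forced.\<close>
  moreover have "(tl_tree ^^ last_cost x ps) ?a \<noteq> Nl \<longleftrightarrow> 2 * last_cost x ps < length ps"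
    by (auto simp: funpow_tl_enc_list)
  ultimately show ?case
    using call_prog[of fn_choices "[enc_vote (x # xs), enc_votes ps]"] Cons
      drop_cost_call[OF x assms(2), of ps "enc_votes ps"] drop_cost_call[OF x assms(2), of ps ?a]
    by (simp add: nth_prog del: enc_list_eq_Nl)
qed

text \<open>Breaks the mutual recursion with \<open>search\<close>: results \<open>R x\<close> and
  step bounds \<open>T x\<close> of the recursive searches are assumed here and supplied by the
  induction on the number of candidates.\<close>

lemma branch_call:
  assumes "\<And>x. x \<in> set xs \<Longrightarrow> size (enc_nat x) < M" "\<And>p. p \<in> set ps \<Longrightarrow> length p < M"
    "length ps < M"
    and IH: "\<And>x acc. x \<in> set xs \<Longrightarrow> last_cost x ps < f \<Longrightarrow>
      halts prog fn_search [enc_votes (map (remove1 x) ps), enc_fuel (f - last_cost x ps),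
        enc_vote (x # suf), enc_votes acc] \<and>
      result prog fn_search [enc_votes (map (remove1 x) ps), enc_fuel (f - last_cost x ps),
        enc_vote (x # suf), enc_votes acc] = enc_votes (rev (map (\<lambda>q. rev q @ x # suf) (R x)) @ acc) \<and>
      steps prog fn_search [enc_votes (map (remove1 x) ps), enc_fuel (f - last_cost x ps),
        enc_vote (x # suf), enc_votes acc] \<le> T x"
  shows "halts prog fn_branch [enc_vote xs, enc_votes ps, enc_fuel f, enc_vote suf, enc_votes acc] \<and>
    result prog fn_branch [enc_vote xs, enc_votes ps, enc_fuel f, enc_vote suf, enc_votes acc] =
      enc_votes (rev (map (\<lambda>q. rev q @ suf)
        (concat (map (\<lambda>x. if last_cost x ps < f then map (Cons x) (R x) else []) xs))) @ acc) \<and>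
    steps prog fn_branch [enc_vote xs, enc_votes ps, enc_fuel f, enc_vote suf, enc_votes acc] \<le>
      500 * M ^ 3 * (length xs + 1) + (\<Sum>x\<leftarrow>xs. if last_cost x ps < f then T x else 0)"
  using assms(1) IH
proof (induction xs arbitrary: acc)
  case Nil
  have "1 \<le> M ^ 3" using assms(3) by simp
  then show ?case
    using call_prog[of fn_branch "[enc_vote [], enc_votes ps, enc_fuel f, enc_vote suf, enc_votes acc]"]
    by (simp add: nth_prog)
next
  case (Cons x xs)
  have x: "size (enc_nat x) < M" using Cons.prems by simp
  define acc' where "acc' = (if last_cost x ps < f then rev (map (\<lambda>q. rev q @ x # suf) (R x)) @ acc else acc)"
  have "200 * M ^ 2 * (length ps + 1) \<le> 200 * M ^ 2 * M"
    using assms(3) by (intro mult_le_mono) auto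
  then have le: "200 * M ^ 2 * (length ps + 1) \<le> 200 * M ^ 3"
    by (simp add: power2_eq_square power3_eq_cube)
  have steps1: "steps prog fn_drop_cost [enc_fuel f, enc_nat x, enc_votes ps] \<le> 200 * M ^ 3"
    "steps prog fn_remove_all [enc_nat x, enc_votes ps] \<le> 200 * M ^ 3"
    using drop_cost_call[OF x assms(2)] remove_all_call[OF x assms(2)] le le_trans by blast+
  have M: "1 \<le> M ^ 3" using assms(3) by simp
  have IH1: "halts prog fn_branch [enc_vote xs, enc_votes ps, enc_fuel f, enc_vote suf, enc_votes acc'] \<and>
    result prog fn_branch [enc_vote xs, enc_votes ps, enc_fuel f, enc_vote suf, enc_votes acc'] =
      enc_votes (rev (map (\<lambda>q. rev q @ suf)
        (concat (map (\<lambda>x. if last_cost x ps < f then map (Cons x) (R x) else []) xs))) @ acc') \<and>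
    steps prog fn_branch [enc_vote xs, enc_votes ps, enc_fuel f, enc_vote suf, enc_votes acc'] \<le>
      500 * M ^ 3 * (length xs + 1) + (\<Sum>x\<leftarrow>xs. if last_cost x ps < f then T x else 0)"
    using Cons.prems by (intro Cons.IH) auto
  note call = call_prog[of fn_branch "[enc_vote (x # xs), enc_votes ps, enc_fuel f, enc_vote suf, enc_votes acc]"]
  show ?case
  proof (cases "last_cost x ps < f")
    case True
    then have "acc' = rev (map (\<lambda>q. rev q @ x # suf) (R x)) @ acc" by (simp add: acc'_def)
    then show ?thesis
      using call IH1 Cons.prems(2)[of x acc] True steps1 M
        drop_cost_call[OF x assms(2), of ps "enc_fuel f"] remove_all_call[OF x assms(2), of ps]
      by (simp add: nth_prog funpow_tl_enc_fuel enc_fuel_eq_Nl comp_def)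
  next
    case False
    then have "acc' = acc" by (simp add: acc'_def)
    then show ?thesis
      using call IH1 False steps1 M drop_cost_call[OF x assms(2), of ps "enc_fuel f"]
      by (simp add: nth_prog funpow_tl_enc_fuel enc_fuel_eq_Nl)
  qed
qed

text \<open>The suffix holds the placed candidates in output order, so rankings are emitted most
  preferred first. \<open>2000 * M ^ 4\<close> pays for the work at one node outside its recursive
  searches.\<close>

lemma search_call:
  assumes "ballots S ps" "card S = k" "finite S" "\<And>x. x \<in> S \<Longrightarrow> size (enc_nat x) < M"
    "k < M" "length ps < M"
  shows "halts prog fn_search [enc_votes ps, enc_fuel f, enc_vote suf, enc_votes acc] \<and>
    result prog fn_search [enc_votes ps, enc_fuel f, enc_vote suf, enc_votes acc] =
      enc_votes (rev (map (\<lambda>q. rev q @ suf) (search k ps f)) @ acc) \<and>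
    steps prog fn_search [enc_votes ps, enc_fuel f, enc_vote suf, enc_votes acc] \<le>
      2000 * M ^ 4 * nodes k ps f"
  using assms
proof (induction k arbitrary: S ps f suf acc)
  case 0
  have "1 \<le> M ^ 4" using "0.prems" by simp
  \<comment> \<open>The program knows no \<open>k\<close>; it recognizes a leaf by an empty first
    vote.\<close>
  moreover have "hd ps = []" "ps \<noteq> []"
    using ballots_length[OF "0.prems"(1), of "hd ps"] ballots_hd[OF "0.prems"(1)] "0.prems"
    by (auto simp: ballots_def)
  ultimately show ?case
    using call_prog[of fn_search "[enc_votes ps, enc_fuel f, enc_vote suf, enc_votes acc]"]
    by (simp add: nth_prog hd_tree_enc_list)
next
  case (Suc k)
  have ps: "ps \<noteq> []" using Suc.prems(1) by (simp add: ballots_def)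
  have len: "length p = Suc k" if "p \<in> set ps" for p
    using ballots_length[OF Suc.prems(1) that] Suc.prems(2) by simp
  have hd: "hd ps \<noteq> []" "length (hd ps) = Suc k" "set (hd ps) = S"
    using len[of "hd ps"] ballots_hd[OF Suc.prems(1)] by auto
  let ?xs = "choices (hd ps) ps"
  let ?T = "\<lambda>x. 2000 * M ^ 4 * nodes k (map (remove1 x) ps) (f - last_cost x ps)"
  have sub: "set ?xs \<subseteq> S" by (rule choices_subset[OF Suc.prems(1)])
  have "length ?xs = card (set ?xs)"
    using distinct_choices[OF Suc.prems(1)] by (simp add: distinct_card)
  also have "\<dots> \<le> Suc k"
    using card_mono[OF Suc.prems(3) sub] Suc.prems(2) by simp
  finally have lxs: "length ?xs + 1 \<le> M" using Suc.prems(5) by simp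
  have choices: "halts prog fn_choices [enc_vote (hd ps), enc_votes ps] \<and>
    result prog fn_choices [enc_vote (hd ps), enc_votes ps] = enc_vote ?xs \<and>
    steps prog fn_choices [enc_vote (hd ps), enc_votes ps] \<le> 500 * M ^ 3 * (length (hd ps) + 1)"
    using Suc.prems ps hd len by (intro choices_call) auto
  have branch: "halts prog fn_branch [enc_vote ?xs, enc_votes ps, enc_fuel f, enc_vote suf, enc_votes acc] \<and>
    result prog fn_branch [enc_vote ?xs, enc_votes ps, enc_fuel f, enc_vote suf, enc_votes acc] =
      enc_votes (rev (map (\<lambda>q. rev q @ suf) (search (Suc k) ps f)) @ acc) \<and>
    steps prog fn_branch [enc_vote ?xs, enc_votes ps, enc_fuel f, enc_vote suf, enc_votes acc] \<le>
      500 * M ^ 3 * (length ?xs + 1) + (\<Sum>x\<leftarrow>?xs. if last_cost x ps < f then ?T x else 0)"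
    unfolding search.simps
  proof (rule branch_call)
    fix x acc assume "x \<in> set ?xs"
    then have "x \<in> S" using sub by auto
    show "halts prog fn_search [enc_votes (map (remove1 x) ps), enc_fuel (f - last_cost x ps),
        enc_vote (x # suf), enc_votes acc] \<and>
      result prog fn_search [enc_votes (map (remove1 x) ps), enc_fuel (f - last_cost x ps),
        enc_vote (x # suf), enc_votes acc] = enc_votes (rev (map (\<lambda>q. rev q @ x # suf)
          (search k (map (remove1 x) ps) (f - last_cost x ps))) @ acc) \<and>
      steps prog fn_search [enc_votes (map (remove1 x) ps), enc_fuel (f - last_cost x ps),
        enc_vote (x # suf), enc_votes acc] \<le> ?T x"
      using Suc.prems \<open>x \<in> S\<close>
      by (intro Suc.IH[of "S - {x}"] ballots_remove1) auto
  qed (use Suc.prems sub len in auto)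
  have "500 * M ^ 3 * (length (hd ps) + 1) \<le> 500 * M ^ 3 * M"
    "500 * M ^ 3 * (length ?xs + 1) \<le> 500 * M ^ 3 * M"
    using hd(2) Suc.prems(5) lxs by (intro mult_le_mono; simp)+
  then have "steps prog fn_choices [enc_vote (hd ps), enc_votes ps] \<le> 500 * M ^ 4"
    "500 * M ^ 3 * (length ?xs + 1) \<le> 500 * M ^ 4"
    using choices by (simp_all add: power3_eq_cube power4_eq_xxxx)
  moreover have "(\<Sum>x\<leftarrow>?xs. if last_cost x ps < f then ?T x else 0) =
    2000 * M ^ 4 * (\<Sum>x\<leftarrow>?xs. if last_cost x ps < f
      then nodes k (map (remove1 x) ps) (f - last_cost x ps) else 0)"
    by (subst sum_list_const_mult[symmetric]) (intro arg_cong[where f = sum_list] map_cong; simp)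
  moreover have "1 \<le> M ^ 4" using Suc.prems by simp
  ultimately show ?case
    using call_prog[of fn_search "[enc_votes ps, enc_fuel f, enc_vote suf, enc_votes acc]"] choices branch hd(1) ps
    by (simp add: nth_prog hd_tree_enc_list del: search.simps)
qed

text \<open>Each round restarts the search with one more unit of fuel. \<open>j\<close> counts the
  failing rounds, and \<open>W\<close> bounds the cost of any round, with 50 steps for the loop
  itself.\<close>

lemma loop_call:
  assumes "ballots S ps" "card S = k" "finite S" "\<And>x. x \<in> S \<Longrightarrow> size (enc_nat x) < M"
    "k < M" "length ps < M"
    and "\<And>i. i < j \<Longrightarrow> search k ps (f + i) = []" "search k ps (f + j) \<noteq> []"
    "\<And>i. i \<le> j \<Longrightarrow> 2000 * M ^ 4 * nodes k ps (f + i) + 50 \<le> W"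
  shows "halts prog fn_loop [enc_votes ps, enc_fuel f] \<and>
    result prog fn_loop [enc_votes ps, enc_fuel f] = enc_votes (rev (map rev (search k ps (f + j)))) \<and>
    steps prog fn_loop [enc_votes ps, enc_fuel f] \<le> (j + 1) * W"
  using assms(7-9)
proof (induction j arbitrary: f)
  case 0
  then show ?case
    using call_prog[of fn_loop "[enc_votes ps, enc_fuel f]"] "0.prems"(3)[of 0]
      search_call[OF assms(1-6), of f "[]" "[]"]
    by (simp add: nth_prog)
next
  case (Suc j)
  have "halts prog fn_loop [enc_votes ps, enc_fuel (Suc f)] \<and>
    result prog fn_loop [enc_votes ps, enc_fuel (Suc f)] =
      enc_votes (rev (map rev (search k ps (Suc f + j)))) \<and>
    steps prog fn_loop [enc_votes ps, enc_fuel (Suc f)] \<le> (j + 1) * W"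
    using Suc.prems(1)[of "Suc _"] Suc.prems(2) Suc.prems(3)[of "Suc _"] by (intro Suc.IH) auto
  moreover have "search k ps f = []" using Suc.prems(1)[of 0] by simp
  ultimately show ?case
    using call_prog[of fn_loop "[enc_votes ps, enc_fuel f]"] Suc.prems(3)[of 0]
      search_call[OF assms(1-6), of f "[]" "[]"]
    by (simp add: nth_prog enc_fuel_Suc)
qed

section \<open>Binary decrement and truncation of the output\<close>

fun spine :: "tree \<Rightarrow> nat" where
  "spine Nl = 0"
| "spine (Cell a b) = Suc (spine b)"

lemma spine_le_size: "spine t \<le> size t"
  by (induction t) auto

text \<open>Subtraction with borrow: an odd number loses its lowest bit, an even one sets it and
  recurs on the half. The \<open>spine\<close> of an encoded number is its number of binary digits,
  which limits the borrow. No leading zero is left behind.\<close>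

lemma pred_call:
  assumes "0 < r"
  shows "halts prog fn_pred [enc_nat r] \<and> result prog fn_pred [enc_nat r] = enc_nat (r - 1) \<and>
    steps prog fn_pred [enc_nat r] \<le> 20 * spine (enc_nat r) \<and>
    spine (enc_nat (r - 1)) \<le> spine (enc_nat r)"
  using assms
proof (induction r rule: less_induct)
  case (less r)
  note call = call_prog[of fn_pred "[enc_nat r]"]
  show ?case
  proof (cases "odd r")
    case True
    then have "enc_nat r = Cell (Cell Nl Nl) (enc_nat (r div 2))"
      using less.prems by (subst enc_nat.simps) auto
    moreover have "enc_nat (r - 1) = (if r div 2 = 0 then Nl else Cell Nl (enc_nat (r div 2)))"
      using True by (subst enc_nat.simps) (auto elim!: oddE)
    moreover have "enc_nat (r div 2) = Nl \<longleftrightarrow> r div 2 = 0"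
      by (subst enc_nat.simps) auto
    ultimately show ?thesis using call by (simp add: nth_prog)
  next
    case False
    with less.prems have r: "0 < r div 2" "r div 2 < r" by (auto elim!: evenE)
    have "enc_nat r = Cell Nl (enc_nat (r div 2))"
      using False less.prems by (subst enc_nat.simps) auto
    moreover have "enc_nat (r - 1) = Cell (Cell Nl Nl) (enc_nat (r div 2 - 1))"
    proof -
      have "(r - 1) div 2 = r div 2 - 1" "odd (r - 1)"
        using False less.prems by (auto elim!: evenE)
      then show ?thesis by (subst enc_nat.simps) auto
    qed
    ultimately show ?thesis using call less.IH[OF r(2,1)] by (simp add: nth_prog)
  qed
qed

text \<open>\<open>r\<close> is binary and may be exponential in the input size. The recursion
  follows the list, so only the number of digits of \<open>r\<close> enters the cost.\<close>

lemma take_call: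
  "halts prog fn_take [enc_nat r, enc_list g qs] \<and>
   result prog fn_take [enc_nat r, enc_list g qs] = enc_list g (take r qs) \<and>
   steps prog fn_take [enc_nat r, enc_list g qs] \<le> 20 * (spine (enc_nat r) + 1) * (length qs + 1)"
proof (induction qs arbitrary: r)
  case Nil
  then show ?case
    using call_prog[of fn_take "[enc_nat r, enc_list g []]"] by (simp add: nth_prog)
next
  case (Cons q qs)
  note call = call_prog[of fn_take "[enc_nat r, enc_list g (q # qs)]"]
  show ?case
  proof (cases r)
    case 0
    then have "enc_nat r = Nl" by (subst enc_nat.simps) simp
    then show ?thesis using call 0 by (simp add: nth_prog)
  next
    case (Suc r')
    then have "enc_nat r \<noteq> Nl" by (subst enc_nat.simps) simp
    moreover have "20 * (spine (enc_nat r') + 1) * (length qs + 1) \<le> 20 * (spine (enc_nat r) + 1) * (length qs + 1)"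
      using pred_call[of r] Suc by (intro mult_le_mono) auto
    then have "steps prog fn_take [enc_nat r', enc_list g qs] \<le> 20 * (spine (enc_nat r) + 1) * (length qs + 1)"
      using Cons.IH[of r'] by linarith
    ultimately show ?thesis using call pred_call[of r] Cons.IH[of r'] Suc by (simp add: nth_prog)
  qed
qed

section \<open>The running time\<close>

text \<open>With fuel one above the optimal score, soundness leaves only optimal rankings and
  completeness yields all of them.\<close>

lemma set_search_optimum:
  assumes "ballots S ps" "card S = k" "finite S" "optimal S ps q"
  shows "set (search k ps (Suc (score q ps))) = {q. optimal S ps q}"
proof (intro set_eqI iffI)
  fix r assume "r \<in> set (search k ps (Suc (score q ps)))"
  then have r: "distinct r \<and> set r = S \<and> score r ps < Suc (score q ps)"
    using assms by (intro search_sound) auto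
  have "score r ps \<le> score s ps" if "distinct s" "set s = S" for s
  proof -
    have "score q ps \<le> score s ps" using that assms(4) unfolding optimal_iff by blast
    then show ?thesis using r by linarith
  qed
  then show "r \<in> {q. optimal S ps q}" using r unfolding optimal_iff by blast
next
  fix r assume r: "r \<in> {q. optimal S ps q}"
  then have "score r ps \<le> score q ps"
    using optimalD[OF assms(4)] unfolding optimal_iff by blast
  then show "r \<in> set (search k ps (Suc (score q ps)))"
    using r assms by (intro search_complete) auto
qed

lemma search_below_optimum:
  assumes "ballots S ps" "card S = k" "finite S" "optimal S ps q" "0 < f" "f \<le> score q ps"
  shows "search k ps f = []"
proof (rule ccontr)
  assume "search k ps f \<noteq> []"
  then obtain r where "r \<in> set (search k ps f)" by (cases "search k ps f") auto
  then have r: "distinct r \<and> set r = S \<and> score r ps < f"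
    using assms by (intro search_sound) auto
  then have "score q ps \<le> score r ps" using assms(4) unfolding optimal_iff by blast
  then show False using r assms(6) by simp
qed

lemma disagreement_le: "disagreement r p \<le> length r * length p"
proof (induction r arbitrary: p)
  case (Cons x r)
  have "disagreement r (remove1 x p) \<le> length r * length (remove1 x p)" by (rule Cons.IH)
  also have "\<dots> \<le> length r * length p" by (simp add: length_remove1)
  finally show ?case using length_after_le[of x p] by simp
qed simp

text \<open>A crude polynomial bound, enough to limit the number of rounds.\<close>

lemma score_le:
  assumes "ballots S ps" "distinct r" "set r = S"
  shows "score r ps \<le> length ps * (card S * card S)"
proof -
  have "disagreement r p \<le> card S * card S" if "p \<in> set ps" for p
    using disagreement_le[of r p] ballots_length[OF assms(1) that] distinct_card[OF assms(2)] assms(3)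
    by simp
  then have "score r ps \<le> (\<Sum>p\<leftarrow>ps. card S * card S)"
    unfolding score_def by (rule sum_list_mono)
  then show ?thesis by (simp add: sum_list_triv)
qed

lemma length_le_size_enc_list: "length xs \<le> size (enc_list g xs)"
  by (induction xs) auto

lemma size_le_size_enc_list: "x \<in> set xs \<Longrightarrow> size (g x) \<le> size (enc_list g xs)"
  by (induction xs) auto

text \<open>Reversing and passing to the relation is a bijection from \<open>set L\<close> to the
  Kemeny rankings, so truncating \<open>L\<close> gives the required number of distinct
  ones.\<close>

lemma distinct_opt_kra_search:
  assumes "ballots (set cs) ps" "optimal (set cs) ps q" "L = search (card (set cs)) ps (Suc (score q ps))"
  shows "distinct_opt_kra (cs, ps, r) (take r (rev (map rev L)))"
proof -
  have set_L: "set L = {q. optimal (set cs) ps q}"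
    using set_search_optimum[OF assms(1) _ _ assms(2)] assms(3) by simp
  have K: "kemeny_rankings (set cs) (votes (cs, ps, r)) = (\<lambda>q. list_ranking (rev q)) ` set L"
    using kemeny_rankings_eq_optimal[OF assms(1)] set_L by simp
  have dL: "distinct q" "set q = set cs" if "q \<in> set L" for q
    using that set_L optimalD by blast+
  have inj: "inj_on (\<lambda>q. list_ranking (rev q)) (set L)"
  proof (rule inj_onI)
    fix a b assume "a \<in> set L" "b \<in> set L" "list_ranking (rev a) = list_ranking (rev b)"
    then have "rev a = rev b" using dL(1) by (intro list_ranking_inject) auto
    then show "a = b" by simp
  qed
  have "distinct L" using distinct_search[OF assms(1)] assms(3) by simp
  then have card: "card (kemeny_rankings (set cs) (votes (cs, ps, r))) = length L"
    unfolding K using inj by (simp add: card_image distinct_card)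
  have dist: "distinct (map list_ranking (rev (map rev L)))"
    using \<open>distinct L\<close> inj by (simp add: rev_map distinct_map comp_def)
  have "distinct p \<and> set p = set cs \<and> list_ranking p \<in> kemeny_rankings (set cs) (votes (cs, ps, r))"
    if p: "p \<in> set (take r (rev (map rev L)))" for p
  proof -
    obtain q where "q \<in> set L" "p = rev q" using in_set_takeD[OF p] by auto
    then show ?thesis using dL[of q] unfolding K by auto
  qed
  moreover have "distinct (map list_ranking (take r (rev (map rev L))))"
    using distinct_take[OF dist, of r] by (simp only: take_map)
  moreover have "length (take r (rev (map rev L))) =
      min r (card (kemeny_rankings (set cs) (votes (cs, ps, r))))"
    unfolding card by simp
  ultimately show ?thesis unfolding distinct_opt_kra_def by simp
qed

lemma prog_runs:
  assumes "(cs, ps, r) \<in> kra_inputs"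
  defines "M \<equiv> input_size (cs, ps, r) + 1" and "d \<equiv> avg_kt_dist (votes (cs, ps, r))"
  shows "\<exists>qs t. runs prog (enc_input (cs, ps, r)) (enc_output qs) t \<and> distinct_opt_kra (cs, ps, r) qs \<and>
    real t \<le> 2300 * (16 powr d * real M ^ 9)"
proof -
  let ?S = "set cs"
  let ?k = "card ?S"
  let ?n = "length ps"
  have bal: "ballots ?S ps" and n2: "2 \<le> ?n"
    using assms(1) by (auto simp: kra_inputs_def ballots_def)
  obtain q where q: "optimal ?S ps q" using optimal_exists by blast
  define b where "b = score q ps"
  define L where "L = search ?k ps (Suc b)"
  \<comment> \<open>Integer bound on the nodes of one round; \<open>M ^ 2\<close> dominates the
    product of \<open>?k + 1\<close> and \<open>?n\<close>.\<close>
  define B where "B = nat \<lfloor>real M ^ 2 * 16 powr d\<rfloor>"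
  have M: "M = size (enc_vote cs) + size (enc_votes ps) + size (enc_nat r) + 3"
    by (simp add: M_def input_size_def)
  have sz: "size (enc_nat x) < M" if "x \<in> ?S" for x
    using size_le_size_enc_list[OF that, of enc_nat] M by simp
  have nM: "?n < M" using length_le_size_enc_list[of ps enc_vote] M by simp
  have kM: "?k < M"
    using length_le_size_enc_list[of cs enc_nat] card_length[of cs] M by linarith
  have d: "b / ?n \<le> d"
    using optimal_score_le_avg[OF bal n2 q] by (simp add: b_def d_def)
  have d0: "0 \<le> d" using order_trans[OF _ d] by simp
  have nodes_B: "nodes ?k ps (Suc i) \<le> B" if "i \<le> b" for i
  proof -
    have "real (nodes ?k ps (Suc i)) \<le> real (?k + 1) * real ?n * 8 powr (i / ?n)"
      by (rule nodes_le[OF bal]) auto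
    also have "\<dots> \<le> real M * real M * 16 powr d"
    proof (intro mult_mono)
      have "i / ?n \<le> b / ?n" using that by (simp add: divide_right_mono)
      then have "(8::real) powr (i / ?n) \<le> 8 powr d" using d by (intro powr_mono) auto
      \<comment> \<open>The search gives base 8; raising it to 16 uses that \<open>d\<close> is
        nonnegative.\<close>
      also have "\<dots> \<le> 16 powr d" using d0 by (intro powr_mono2) auto
      finally show "(8::real) powr (i / ?n) \<le> 16 powr d" .
    qed (use kM nM in auto)
    finally show ?thesis
      unfolding B_def by (simp add: le_nat_iff le_floor_iff power2_eq_square)
  qed
  have loop: "halts prog fn_loop [enc_votes ps, enc_fuel 1] \<and>
    result prog fn_loop [enc_votes ps, enc_fuel 1] = enc_votes (rev (map rev (search ?k ps (1 + b)))) \<and>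
    steps prog fn_loop [enc_votes ps, enc_fuel 1] \<le> (b + 1) * (2000 * M ^ 4 * B + 50)"
  proof (rule loop_call[OF bal refl _ sz kM nM])
    show "search ?k ps (1 + i) = []" if "i < b" for i
      using that by (intro search_below_optimum[OF bal refl _ q]) (auto simp: b_def)
    have "q \<in> set (search ?k ps (1 + b))"
      using set_search_optimum[OF bal refl _ q] q by (simp add: b_def)
    then show "search ?k ps (1 + b) \<noteq> []" by auto
    show "2000 * M ^ 4 * nodes ?k ps (1 + i) + 50 \<le> 2000 * M ^ 4 * B + 50" if "i \<le> b" for i
      using nodes_B[OF that] by simp
  qed auto
  have fuel: "enc_fuel (Suc 0) = Cell Nl Nl" by (simp add: enc_fuel_def)
  let ?qs = "take r (rev (map rev L))"
  let ?args = "[enc_input (cs, ps, r)]"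
  have take: "halts prog fn_take [enc_nat r, enc_votes (rev (map rev L))] \<and>
    result prog fn_take [enc_nat r, enc_votes (rev (map rev L))] = enc_votes ?qs \<and>
    steps prog fn_take [enc_nat r, enc_votes (rev (map rev L))] \<le> 20 * (spine (enc_nat r) + 1) * (length L + 1)"
    using take_call[of r enc_vote "rev (map rev L)"] by simp
  have main: "halts prog 0 ?args \<and> result prog 0 ?args = enc_votes ?qs \<and>
    steps prog 0 ?args \<le> 20 + (b + 1) * (2000 * M ^ 4 * B + 50) + 20 * (spine (enc_nat r) + 1) * (length L + 1)"
    using call_prog[of 0 ?args] loop take by (simp add: nth_prog fuel L_def)
  have "evals prog ?args [Var 0] ?args 2"
    using evals_Cons[OF eval_Var[of 0 ?args prog] evals_Nil[of prog ?args]] by (simp add: numeral_2_eq_2)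
  moreover have "eval prog ?args (prog ! 0) (enc_output ?qs) (steps prog 0 ?args)"
    using eval_halts[of prog 0 ?args] main by (simp add: enc_output_def)
  ultimately have "runs prog (enc_input (cs, ps, r)) (enc_output ?qs) (2 + steps prog 0 ?args + 1)"
    unfolding runs_def by (intro eval_Call) (simp_all add: length_prog)
  moreover have "distinct_opt_kra (cs, ps, r) ?qs"
    using distinct_opt_kra_search[OF bal q] by (simp add: L_def b_def)
  moreover have "real (2 + steps prog 0 ?args + 1) \<le> 2300 * (16 powr d * real M ^ 9)"
  proof -
    have "b \<le> ?n * (?k * ?k)"
      using score_le[OF bal] optimalD[OF q] by (simp add: b_def)
    also have "\<dots> \<le> ?n * (M * M)"
      using kM by (intro mult_le_mono) auto
    finally have "b + 1 \<le> ?n * (M * M) + M * M"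
      using nM by (auto intro: order_trans)
    also have "\<dots> = (?n + 1) * (M * M)" by simp
    also have "\<dots> \<le> M * (M * M)"
      using nM by (intro mult_le_mono) auto
    finally have b: "b + 1 \<le> M ^ 3" by (simp add: power3_eq_cube)
    have B1: "1 \<le> B" using nodes_B[of 0] by (cases ?k) auto
    have M1: "1 \<le> M" using nM by simp
    have "2000 * M ^ 4 * B + 50 \<le> 2050 * (M ^ 4 * B)"
      using M1 B1 by simp
    then have 1: "(b + 1) * (2000 * M ^ 4 * B + 50) \<le> M ^ 3 * (2050 * (M ^ 4 * B))"
      using b by (intro mult_le_mono)
    have "length L \<le> B"
      using length_search_le_nodes[of ?k ps "Suc b"] nodes_B[of b] by (simp add: L_def)
    moreover have "spine (enc_nat r) + 1 \<le> M"
      using spine_le_size[of "enc_nat r"] M by simp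
    ultimately have "20 * (spine (enc_nat r) + 1) * (length L + 1) \<le> 20 * M * (B + B)"
      using B1 by (intro mult_le_mono) auto
    also have "\<dots> = 40 * (M * B)" by simp
    also have "\<dots> \<le> 40 * (M ^ 7 * B)"
      using M1 by (intro mult_le_mono) (auto intro: self_le_power)
    finally have 2: "20 * (spine (enc_nat r) + 1) * (length L + 1) \<le> 40 * (M ^ 7 * B)" .
    have "1 \<le> M ^ 7 * B" using M1 B1 by simp
    moreover have "M ^ 3 * (2050 * (M ^ 4 * B)) = 2050 * (M ^ 7 * B)"
      by (simp flip: power_add)
    \<comment> \<open>The loop contributes 2050, the truncation 40 and the fixed overhead
      23.\<close>
    ultimately have "2 + steps prog 0 ?args + 1 \<le> 2300 * (M ^ 7 * B)"
      using main 1 2 by linarith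
    then have "real (2 + steps prog 0 ?args + 1) \<le> real (2300 * (M ^ 7 * B))"
      by (rule of_nat_mono)
    also have "\<dots> = 2300 * (real M ^ 7 * real B)" by simp
    \<comment> \<open>\<open>B\<close> brings in the factor \<open>M ^ 2\<close> that makes the
      exponent 9.\<close>
    also have "\<dots> \<le> 2300 * (real M ^ 7 * (real M ^ 2 * 16 powr d))"
      by (intro mult_left_mono) (auto simp: B_def)
    also have "\<dots> = 2300 * (16 powr d * real M ^ 9)"
      by (simp flip: power_add)
    finally show ?thesis .
  qed
  ultimately show ?thesis by blast
qed

theorem theorem3:
  shows "\<exists>(P :: program) (T :: kra_input \<Rightarrow> nat).
    (\<forall>x\<in>kra_inputs. \<exists>qs. runs P (enc_input x) (enc_output qs) (T x) \<and> distinct_opt_kra x qs) \<and>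
    (\<lambda>x. real (T x)) \<in> O_star kra_inputs input_size (\<lambda>x. 16 powr avg_kt_dist (votes x))"
proof -
  have "\<forall>x\<in>kra_inputs. \<exists>t. (\<exists>qs. runs prog (enc_input x) (enc_output qs) t \<and> distinct_opt_kra x qs) \<and>
      real t \<le> 2300 * (16 powr avg_kt_dist (votes x) * real (input_size x + 1) ^ 9)"
  proof
    fix x assume "x \<in> kra_inputs"
    then show "\<exists>t. (\<exists>qs. runs prog (enc_input x) (enc_output qs) t \<and> distinct_opt_kra x qs) \<and>
      real t \<le> 2300 * (16 powr avg_kt_dist (votes x) * real (input_size x + 1) ^ 9)"
      using prog_runs by (cases x) blast
  qed
  then obtain T where T: "\<And>x. x \<in> kra_inputs \<Longrightarrow>
      (\<exists>qs. runs prog (enc_input x) (enc_output qs) (T x) \<and> distinct_opt_kra x qs) \<and>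
      real (T x) \<le> 2300 * (16 powr avg_kt_dist (votes x) * real (input_size x + 1) ^ 9)"
    by (metis bchoice)
  have "(\<lambda>x. real (T x)) \<in> O_star kra_inputs input_size (\<lambda>x. 16 powr avg_kt_dist (votes x))"
    unfolding O_star_def
  proof (intro CollectI exI ballI)
    fix x assume "x \<in> kra_inputs"
    \<comment> \<open>The witnesses left open by \<open>exI\<close> are fixed here: the constant
      2300 and the polynomial \<open>[:1, 1:] ^ 9\<close>, whose value at the input size is the
      ninth power of its successor.\<close>
    then show "\<bar>real (T x)\<bar> \<le> 2300 *
        \<bar>16 powr avg_kt_dist (votes x) * poly ([:1, 1:] ^ 9) (real (input_size x))\<bar>"
      using T[of x] by (simp add: poly_power add.commute abs_mult)
  qed
  then show ?thesis using T by blast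
qed

end
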